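(* Let $p\in(1,\infty)$, let $\mu_1,\dots,\mu_N\in\mathcal P(\Omega)$ and let $(\lambda_i)_{i\in[N]}\in\Delta_N$. Then the weak centroid problem $$\mathrm{wC}(\mu_1,\dots,\mu_N)=\inf_{\nu\in\mathcal P(\Omega)}\ \sum_{i=M+1}^N\lambda_i\mathcal T_p(\mu_i|\nu)+\sum_{i=1}^M\lambda_i\mathcal T_p(\nu|\mu_i)$$ admits a minimizer $\bar\nu\in\mathcal P(\Omega)$.
   Context: $\Omega\subset\mathbb R^d$ is a fixed compact convex set, $\mathcal P(\Omega)$ is the set of Borel probability measures on $\Omega$, and $0\le M\le N$ are fixed integers with $N>0$. $[N]=\{1,\dots,N\}$ and $\Delta_N=\{(\lambda_i)_{i\in[N]}\in(0,1)^N:\sum_{i=1}^N\lambda_i=1\}$. For $\mu,\nu\in\mathcal P(\Omega)$, $\Pi(\mu,\nu)$ is the set of couplings of $\mu$ and $\nu$ (measures in $\mathcal P(\Omega^2)$ with first marginal $\mu$ and second marginal $\nu$). The weak optimal transport cost with barycentric cost is $$\mathcal T_p(\nu|\mu)=\inf_{\gamma\in\Pi(\mu,\nu)}\int_\Omega\Big|x-\int_\Omega y\,d\gamma_x(y)\Big|^p\,d\mu(x),$$ where $d\gamma(x,y)=d\gamma_x(y)\,d\mu(x)$ is the disintegration of $\gamma$ with respect to its first marginal. *)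

theory Defs
  imports "HOL-Probability.Probability"
begin

definition borel_probs :: "'a::topological_space set \<Rightarrow> 'a measure set" where
  "borel_probs \<Omega> = space (prob_algebra (restrict_space borel \<Omega>))"

definition couplings ::
    "'a::euclidean_space set \<Rightarrow> 'a measure \<Rightarrow> 'a measure \<Rightarrow> ('a \<times> 'a) measure set" where
  "couplings \<Omega> \<mu> \<nu> = {\<gamma> \<in> borel_probs (\<Omega> \<times> \<Omega>).
     distr \<gamma> (restrict_space borel \<Omega>) fst = \<mu> \<and> distr \<gamma> (restrict_space borel \<Omega>) snd = \<nu>}"

text \<open>The formula \<open>d\<gamma>(x,y) = d\<gamma>\<^sub>x(y) d\<mu>(x)\<close>, where \<open>\<mu>\<close> is the first marginal
  of \<open>\<gamma>\<close> and \<open>x \<mapsto> \<gamma>\<^sub>x\<close> is a Markov kernel on \<open>\<Omega>\<close>, tested on all Borel subsets of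
  \<open>\<Omega> \<times> \<Omega>\<close>.\<close>

definition is_disintegration ::
    "'a::euclidean_space set \<Rightarrow> ('a \<times> 'a) measure \<Rightarrow> ('a \<Rightarrow> 'a measure) \<Rightarrow> bool" where
  "is_disintegration \<Omega> \<gamma> K \<longleftrightarrow>
     K \<in> restrict_space borel \<Omega> \<rightarrow>\<^sub>M prob_algebra (restrict_space borel \<Omega>) \<and>
     (\<forall>C \<in> sets (restrict_space borel (\<Omega> \<times> \<Omega>)).
        emeasure \<gamma> C =
          (\<integral>\<^sup>+ x. (\<integral>\<^sup>+ y. indicator C (x, y) \<partial>K x) \<partial>distr \<gamma> (restrict_space borel \<Omega>) fst))"

text \<open>For compact \<open>\<Omega>\<close> every \<open>\<gamma> \<in> borel_probs (\<Omega> \<times> \<Omega>)\<close> has a disintegration, and any two of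
  them agree almost everywhere for the first marginal, so the choice made here does not affect
  the costs below.\<close>

definition disintegration ::
    "'a::euclidean_space set \<Rightarrow> ('a \<times> 'a) measure \<Rightarrow> 'a \<Rightarrow> 'a measure" where
  "disintegration \<Omega> \<gamma> = (SOME K. is_disintegration \<Omega> \<gamma> K)"

text \<open>\<open>weak_cost \<Omega> p \<nu> \<mu>\<close> is \<open>T\<^sub>p(\<nu>|\<mu>)\<close>: the conditioning measure \<open>\<mu>\<close>, which is the first
  marginal of the couplings, is the last argument.\<close>

definition weak_cost ::
    "'a::euclidean_space set \<Rightarrow> real \<Rightarrow> 'a measure \<Rightarrow> 'a measure \<Rightarrow> ennreal" where
  "weak_cost \<Omega> p \<nu> \<mu> =
     (INF \<gamma> \<in> couplings \<Omega> \<mu> \<nu>.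
        \<integral>\<^sup>+ x. ennreal (norm (x - (\<integral> y. y \<partial>disintegration \<Omega> \<gamma> x)) powr p) \<partial>\<mu>)"

definition open_simplex :: "nat \<Rightarrow> (nat \<Rightarrow> real) set" where
  "open_simplex N = {w. (\<forall>i \<in> {1..N}. w i \<in> {0<..<1}) \<and> (\<Sum>i = 1..N. w i) = 1}"

definition weak_centroid_objective ::
    "'a::euclidean_space set \<Rightarrow> real \<Rightarrow> nat \<Rightarrow> nat \<Rightarrow> (nat \<Rightarrow> real) \<Rightarrow> (nat \<Rightarrow> 'a measure)
      \<Rightarrow> 'a measure \<Rightarrow> ennreal" where
  "weak_centroid_objective \<Omega> p M N w \<mu> \<nu> =
     (\<Sum>i = M + 1..N. ennreal (w i) * weak_cost \<Omega> p (\<mu> i) \<nu>) +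
     (\<Sum>i = 1..M. ennreal (w i) * weak_cost \<Omega> p \<nu> (\<mu> i))"

definition weak_centroid_value ::
    "'a::euclidean_space set \<Rightarrow> real \<Rightarrow> nat \<Rightarrow> nat \<Rightarrow> (nat \<Rightarrow> real) \<Rightarrow> (nat \<Rightarrow> 'a measure)
      \<Rightarrow> ennreal" where
  "weak_centroid_value \<Omega> p M N w \<mu> =
     (INF \<nu> \<in> borel_probs \<Omega>. weak_centroid_objective \<Omega> p M N w \<mu> \<nu>)"

end

theory Submission
  imports Defs
begin

text \<open>The minimizer comes from the direct method: every sequence of probability measures on the compact
  set \<open>\<Omega>\<close> has a weakly convergent subsequence (\<open>weakly_compact_borel_probs\<close>), and
  \<open>(\<mu>, \<nu>) \<mapsto> T\<^sub>p(\<nu>|\<mu>)\<close> is jointly lower semicontinuous for weak convergence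
  (\<open>weak_cost_lower_semicontinuous\<close>). A weak limit of a minimizing sequence is then a
  minimizer, the sum over \<open>i\<close> being handled by Fatou's lemma.

  Lower semicontinuity is the heart of the matter. The cost of a coupling \<open>\<gamma>\<close> involves the
  conditional means \<open>\<integral> y d\<gamma>\<^sub>x(y)\<close>, and these do not depend continuously on \<open>\<gamma>\<close>. The remedy is
  to record the conditional mean as a third coordinate. A barycentric plan is the law of a triple
  \<open>(x, b, y)\<close> with prescribed marginals in \<open>x\<close> and \<open>y\<close>, in which \<open>b\<close> and \<open>y\<close> have the same
  conditional mean given \<open>x\<close>; its cost is the integral of the continuous function \<open>|x - b|\<^sup>p\<close>.
  Tested against continuous functions of \<open>x\<close>, the condition on \<open>b\<close> survives weak limits, so
  plans and their costs behave well in the limit (\<open>barycentric_plans_weakly_closed\<close>). Passing to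
  plans does not change the infimum: a coupling yields a plan of the same cost by taking for
  \<open>b\<close> the conditional mean (\<open>plan_of_coupling\<close>), and forgetting \<open>b\<close> in a plan yields a
  coupling whose cost is no larger, which is the conditional Jensen inequality
  (\<open>weak_cost_le_plan_cost\<close>).

  Both weak compactness and the existence of disintegrations are obtained from the real line. A
  compact set \<open>K\<close> in a Euclidean space is the continuous image \<open>g ` C\<close> of a compact set \<open>C\<close> of
  reals, and \<open>g\<close> has a Borel right inverse \<open>s\<close>. Measures are pushed to the reals by \<open>s\<close> and
  back to \<open>K\<close> by \<open>g\<close>; in between, Helly's selection theorem gives compactness, and conditional
  quantile functions give the disintegration.\<close>

section \<open>Compact sets as continuous images of compact sets of reals\<close>

text \<open>For \<open>q = 1/2\<close> this is the value of a binary expansion; for \<open>q = 1/3\<close> it parametrizes a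
  Cantor set.\<close>

definition base_value :: "real \<Rightarrow> (nat \<Rightarrow> bool) \<Rightarrow> real" where
  "base_value q b = (\<Sum>k. of_bool (b k) * q ^ Suc k)"

lemma summable_base_value:
  assumes "0 \<le> q" "q < 1"
  shows "summable (\<lambda>k. of_bool (b k) * q ^ Suc k :: real)"
proof (rule summable_comparison_test')
  show "summable (\<lambda>k. q ^ k)" using assms by simp
  show "norm (of_bool (b k) * q ^ Suc k :: real) \<le> q ^ k" for k
    using assms mult_left_le_one_le[of "q^k" q] by (auto simp: abs_mult)
qed

lemma continuous_on_base_value:
  assumes "0 \<le> q" "q < 1"
  shows "continuous_on UNIV (base_value q)"
proof -
  have lim: "uniform_limit UNIV (\<lambda>n b. \<Sum>k<n. of_bool (b k) * q ^ Suc k :: real)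
      (\<lambda>b. \<Sum>k. of_bool (b k) * q ^ Suc k) sequentially"
  proof (rule Weierstrass_m_test)
    show "summable (\<lambda>k. q ^ k)" using assms by simp
    show "norm (of_bool (b k) * q ^ Suc k :: real) \<le> q ^ k" for k and b :: "nat \<Rightarrow> bool"
      using assms mult_left_le_one_le[of "q^k" q] by (auto simp: abs_mult)
  qed
  have "continuous_on UNIV (\<lambda>b :: nat \<Rightarrow> bool. of_bool (b k) :: real)" for k
  proof -
    have "continuous_on UNIV (of_bool :: bool \<Rightarrow> real)"
      by (simp add: continuous_on_open_vimage open_discrete)
    from continuous_on_compose2[OF this continuous_on_product_coordinates[of k]]
    show ?thesis by simp
  qed
  then have cont: "continuous_on UNIV (\<lambda>b :: nat \<Rightarrow> bool. \<Sum>k<n. of_bool (b k) * q ^ Suc k)" for n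
    by (intro continuous_on_sum continuous_on_mult_right)
  show ?thesis
    unfolding base_value_def[abs_def]
    by (rule uniform_limit_theorem[OF always_eventually[OF allI, OF cont] lim sequentially_bot])
qed

lemma base_value_Suc:
  assumes "0 \<le> q" "q < 1"
  shows "base_value q b = q * (of_bool (b 0) + base_value q (\<lambda>k. b (Suc k)))"
proof -
  have "base_value q b = of_bool (b 0) * q ^ Suc 0 + (\<Sum>k. of_bool (b (Suc k)) * q ^ Suc (Suc k))"
    unfolding base_value_def using suminf_split_head[OF summable_base_value[OF assms, of b]] by simp
  also have "(\<Sum>k. of_bool (b (Suc k)) * q ^ Suc (Suc k)) = (\<Sum>k. q * (of_bool (b (Suc k)) * q ^ Suc k))"
    by (simp add: mult_ac)
  also have "\<dots> = q * base_value q (\<lambda>k. b (Suc k))"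
    unfolding base_value_def by (rule suminf_mult[OF summable_base_value[OF assms]])
  finally show ?thesis by (simp add: algebra_simps)
qed

lemma base_value_bounds:
  assumes "0 \<le> q" "q < 1"
  shows "0 \<le> base_value q b" and "base_value q b \<le> q / (1 - q)"
proof -
  show "0 \<le> base_value q b"
    unfolding base_value_def by (intro suminf_nonneg summable_base_value assms) (use assms in auto)
  have s: "(\<lambda>k. q * q ^ k) sums (q * (1 / (1 - q)))"
    by (intro sums_mult geometric_sums) (use assms in auto)
  have "base_value q b \<le> (\<Sum>k. q * q ^ k)"
    unfolding base_value_def using assms
    by (intro suminf_le summable_base_value sums_summable[OF s]) auto
  then show "base_value q b \<le> q / (1 - q)" using sums_unique[OF s] by simp
qed

text \<open>The digits after the first one contribute at most half a unit of the first, so the value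
  determines the first digit, and after a shift every other digit.\<close>

lemma inj_base_value_third: "inj (base_value (1 / 3))"
proof (rule injI)
  fix b c :: "nat \<Rightarrow> bool"
  have digit: "b 0 = c 0 \<and> base_value (1/3) (\<lambda>k. b (Suc k)) = base_value (1/3) (\<lambda>k. c (Suc k))"
    if "base_value (1/3) b = base_value (1/3) c" for b c :: "nat \<Rightarrow> bool"
    using that base_value_Suc[of "1/3" b] base_value_Suc[of "1/3" c]
      base_value_bounds[of "1/3" "\<lambda>k. b (Suc k)"] base_value_bounds[of "1/3" "\<lambda>k. c (Suc k)"]
    by (cases "b 0"; cases "c 0") auto
  assume "base_value (1/3) b = base_value (1/3) c"
  then have "base_value (1/3) (\<lambda>k. b (k + n)) = base_value (1/3) (\<lambda>k. c (k + n))" for n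
    proof (induction n)
    case (Suc n)
    from digit[OF Suc.IH[OF Suc.prems]] show ?case by simp
  qed simp
  from digit[OF this] show "b = c" by auto
qed

lemma binary_expansion:
  assumes "0 \<le> x" "x < 1"
  shows "\<exists>b. base_value (1 / 2) b = x"
proof -
  define b where "b k = odd \<lfloor>2 ^ Suc k * x\<rfloor>" for k
  \<comment> \<open>Truncating the expansion of \<open>x\<close> after \<open>n\<close> digits rounds \<open>x\<close> down to a multiple of \<open>2\<^sup>-\<^sup>n\<close>.\<close>
  have partial: "(\<Sum>k<n. of_bool (b k) * (1 / 2) ^ Suc k) = (of_int \<lfloor>2 ^ n * x\<rfloor> / 2 ^ n :: real)" for n
  proof (induction n)
    case 0
    have "\<lfloor>x\<rfloor> = 0" using assms by linarith
    then show ?case by simp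
  next
    case (Suc n)
    define m where "m = \<lfloor>2 ^ n * x\<rfloor>"
    have "\<lfloor>2 ^ Suc n * x\<rfloor> div 2 = m"
      using floor_divide_real_eq_div[of 2 "2 ^ Suc n * x"] by (simp add: m_def)
    then have "\<lfloor>2 ^ Suc n * x\<rfloor> = 2 * m + of_bool (b n)"
      using mult_div_mod_eq[of 2 "\<lfloor>2 ^ Suc n * x\<rfloor>"] unfolding b_def of_bool_odd_eq_mod_2 by linarith
    then have "real_of_int \<lfloor>2 ^ Suc n * x\<rfloor> = 2 * of_int m + of_bool (b n)" by simp
    moreover have "(\<Sum>k<n. of_bool (b k) * (1 / 2) ^ Suc k) = real_of_int m / 2 ^ n"
      using Suc by (simp only: m_def)
    ultimately show ?case
      by (simp only: sum.lessThan_Suc) (simp add: field_simps)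
  qed
  have "(\<lambda>n. of_int \<lfloor>2 ^ n * x\<rfloor> / 2 ^ n) \<longlonglongrightarrow> x"
  proof (rule tendsto_sandwich)
    show "(\<lambda>n. x - (1 / 2) ^ n) \<longlonglongrightarrow> x"
      using tendsto_diff[OF tendsto_const LIMSEQ_realpow_zero[of "1 / 2"], of x] by simp
    show "\<forall>\<^sub>F n in sequentially. x - (1 / 2) ^ n \<le> of_int \<lfloor>2 ^ n * x\<rfloor> / 2 ^ n"
    proof (intro always_eventually allI)
      fix n
      have "(2 ^ n * x - 1) / 2 ^ n \<le> of_int \<lfloor>2 ^ n * x\<rfloor> / 2 ^ n"
        by (intro divide_right_mono) (linarith, simp)
      then show "x - (1 / 2) ^ n \<le> of_int \<lfloor>2 ^ n * x\<rfloor> / 2 ^ n"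
        by (simp add: diff_divide_distrib power_one_over)
    qed
    show "\<forall>\<^sub>F n in sequentially. of_int \<lfloor>2 ^ n * x\<rfloor> / 2 ^ n \<le> x"
    proof (intro always_eventually allI)
      fix n
      have "of_int \<lfloor>2 ^ n * x\<rfloor> \<le> 2 ^ n * x" by linarith
      then show "of_int \<lfloor>2 ^ n * x\<rfloor> / 2 ^ n \<le> x" by (simp add: pos_divide_le_eq mult.commute)
    qed
  qed auto
  then have "(\<lambda>k. of_bool (b k) * (1 / 2) ^ Suc k) sums x"
    unfolding sums_def partial .
  then have "base_value (1 / 2) b = x" unfolding base_value_def by (rule sums_unique[symmetric])
  then show ?thesis by blast
qed

text \<open>Sending a sequence of bits to a point whose coordinates have these bits as binary digits is a
  continuous map of the Cantor space whose image covers a half-open cube, hence \<open>K\<close>. Expansions in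
  base \<open>3\<close> realize the Cantor space as a compact set of reals, of which the part lying over \<open>K\<close>
  is kept.\<close>

lemma compact_imp_continuous_image_of_compact_reals:
  fixes K :: "'b::euclidean_space set"
  assumes "compact K"
  obtains C :: "real set" and g :: "real \<Rightarrow> 'b"
  where "compact C" "continuous_on C g" "g ` C = K"
proof -
  \<comment> \<open>The bound is strict because the binary expansions used cover only \<open>[0, 1)\<close>.\<close>
  obtain R where R: "R > 0" "\<And>x. x \<in> K \<Longrightarrow> norm x < R"
    using compact_imp_bounded[OF assms] unfolding bounded_pos_less by blast
  obtain e :: "'b \<Rightarrow> nat" where e: "inj_on e Basis"
    using finite_imp_inj_to_nat_seg[OF finite_Basis] by metis
  \<comment> \<open>Bit \<open>prod_encode (e i, k)\<close> is the \<open>k\<close>-th digit of the coordinate along \<open>i\<close>, rescaled from \<open>[0, 1)\<close> to \<open>[- R, R)\<close>.\<close>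
  define h where "h b = (\<Sum>i\<in>Basis. (2 * R * base_value (1/2) (\<lambda>k. b (prod_encode (e i, k))) - R) *\<^sub>R (i::'b))"
    for b :: "nat \<Rightarrow> bool"
  have cont_h: "continuous_on UNIV h"
  proof -
    have "continuous_on UNIV (\<lambda>b k. b (prod_encode (e i, k)) :: bool)" for i :: 'b
      by (intro continuous_on_coordinatewise_then_product continuous_on_product_coordinates)
    then have "continuous_on UNIV (\<lambda>b. base_value (1/2) (\<lambda>k. b (prod_encode (e i, k))))" for i :: 'b
      by (intro continuous_on_compose2[OF continuous_on_base_value]) auto
    then show ?thesis unfolding h_def by (intro continuous_intros)
  qed
  have surj: "\<exists>b. h b = x" if "x \<in> K" for x
  proof -
    have "\<exists>b. base_value (1/2) b = (x \<bullet> i + R) / (2 * R)" if i: "i \<in> Basis" for i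
    proof (rule binary_expansion)
      have "\<bar>x \<bullet> i\<bar> < R" using R(2)[OF \<open>x \<in> K\<close>] Basis_le_norm[OF i, of x] by simp
      then show "0 \<le> (x \<bullet> i + R) / (2 * R)" "(x \<bullet> i + R) / (2 * R) < 1"
        using R(1) by (auto simp: field_simps)
    qed
    then obtain c where c: "\<And>i. i \<in> Basis \<Longrightarrow> base_value (1/2) (c i) = (x \<bullet> i + R) / (2 * R)"
      by metis
    define b where "b n = c (inv_into Basis e (fst (prod_decode n))) (snd (prod_decode n))" for n
    have "(\<lambda>k. b (prod_encode (e i, k))) = c i" if "i \<in> Basis" for i
      using that e by (simp add: b_def)
    then have "h b = (\<Sum>i\<in>Basis. (x \<bullet> i) *\<^sub>R i)"
      unfolding h_def using c R(1) by (intro sum.cong) (auto simp: field_simps)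
    then show ?thesis by (auto simp: euclidean_representation)
  qed
  have "compact (UNIV :: (nat \<Rightarrow> bool) set)"
  proof -
    have "compact (UNIV :: bool set)" by (simp add: finite_imp_compact)
    then have "compactin (product_topology (\<lambda>_::nat. euclidean :: bool topology) UNIV) (PiE UNIV (\<lambda>_. UNIV))"
      by (subst compactin_PiE) simp
    then show ?thesis by (simp add: euclidean_product_topology)
  qed
  from homeomorphism_compact[OF this continuous_on_base_value refl inj_base_value_third]
  obtain d where d: "homeomorphism UNIV (range (base_value (1/3))) (base_value (1/3)) d" by auto
  let ?C = "range (base_value (1/3)) \<inter> d -` (h -` K)"
  have "closed (h -` K)"
    using continuous_on_closed_vimage[of UNIV h] cont_h compact_imp_closed[OF assms] by auto
  moreover have "?C = base_value (1/3) ` (h -` K)"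
    using d by (auto simp: homeomorphism_def)
  ultimately have "compact ?C"
    using \<open>compact UNIV\<close> continuous_on_base_value[of "1/3"] closed_Int_compact[of "h -` K" UNIV]
    by (auto intro!: compact_continuous_image intro: continuous_on_subset)
  moreover have "continuous_on ?C (h \<circ> d)"
    by (intro continuous_on_compose continuous_on_subset[OF homeomorphism_cont2[OF d]]
        continuous_on_subset[OF cont_h]) auto
  moreover have "(h \<circ> d) ` ?C = K"
  proof (intro equalityI subsetI)
    fix x assume "x \<in> K"
    then obtain b where "h b = x" using surj by blast
    moreover have "d (base_value (1/3) b) = b" using d by (simp add: homeomorphism_def)
    ultimately show "x \<in> (h \<circ> d) ` ?C"
      using \<open>x \<in> K\<close> by (intro image_eqI[of _ _ "base_value (1/3) b"]) auto
  qed auto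
  ultimately show ?thesis by (rule that)
qed

text \<open>The least parameter of a point is a Borel function of the point because it is lower
  semicontinuous: its sublevel sets are the images of the compact sets \<open>C \<inter> {..a}\<close>.\<close>

lemma measurable_right_inverse_compact:
  fixes g :: "real \<Rightarrow> 'b::euclidean_space"
  assumes "compact C" "continuous_on C g" "g ` C = K"
  obtains s where "s \<in> borel_measurable (restrict_space borel K)"
    "\<And>x. x \<in> K \<Longrightarrow> s x \<in> C \<and> g (s x) = x"
proof -
  define s where "s x = Inf {t \<in> C. g t = x}" for x
  have fibre: "compact {t \<in> C. g t = x}" for x
  proof -
    have "closedin (top_of_set C) (C \<inter> g -` {x})"
      by (rule continuous_closedin_preimage[OF assms(2)]) auto
    then have "closed (C \<inter> g -` {x})"
      using assms(1) closedin_closed_trans compact_imp_closed by blast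
    then have "compact (C \<inter> (C \<inter> g -` {x}))"
      by (rule compact_Int_closed[OF assms(1)])
    moreover have "C \<inter> (C \<inter> g -` {x}) = {t \<in> C. g t = x}" by auto
    ultimately show ?thesis by simp
  qed
  have s: "s x \<in> {t \<in> C. g t = x}" if "x \<in> K" for x
  proof -
    have "{t \<in> C. g t = x} \<noteq> {}" using that assms(3) by auto
    then show ?thesis unfolding s_def
      by (intro closed_contains_Inf compact_imp_closed fibre bounded_imp_bdd_below compact_imp_bounded)
  qed
  have "s \<in> borel_measurable (restrict_space borel K)"
  proof (rule borel_measurableI_le)
    fix a
    have K: "K \<in> sets borel"
      using assms compact_continuous_image compact_imp_closed borel_closed by blast
    have "{x \<in> space (restrict_space borel K). s x \<le> a} = g ` (C \<inter> {..a})"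
    proof (intro equalityI subsetI)
      fix x assume "x \<in> {x \<in> space (restrict_space borel K). s x \<le> a}"
      then show "x \<in> g ` (C \<inter> {..a})"
        using s[of x] by (intro image_eqI[of _ _ "s x"]) (auto simp: space_restrict_space)
    next
      fix x assume "x \<in> g ` (C \<inter> {..a})"
      then obtain t where t: "t \<in> C" "t \<le> a" "x = g t" by auto
      have "s x \<le> t" unfolding s_def using t
        by (intro cInf_lower bounded_imp_bdd_below compact_imp_bounded fibre) auto
      with t show "x \<in> {x \<in> space (restrict_space borel K). s x \<le> a}"
        using assms(3) by (auto simp: space_restrict_space)
    qed
    moreover have "compact (g ` (C \<inter> {..a}))"
      using assms by (intro compact_continuous_image compact_Int_closed continuous_on_subset[OF assms(2)]) auto
    ultimately show "{x \<in> space (restrict_space borel K). s x \<le> a} \<in> sets (restrict_space borel K)"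
      using K assms(3) by (auto simp: sets_restrict_space_iff intro!: borel_closed compact_imp_closed)
  qed
  with s that show ?thesis by blast
qed

section \<open>Weak convergence of probability measures on a compact set\<close>

lemma borel_probs_iff:
  "M \<in> borel_probs K \<longleftrightarrow> sets M = sets (restrict_space borel K) \<and> prob_space M"
  by (simp add: borel_probs_def space_prob_algebra)

lemma space_borel_probs: "M \<in> borel_probs K \<Longrightarrow> space M = K"
  using sets_eq_imp_space_eq[of M "restrict_space borel K"] by (simp add: borel_probs_iff space_restrict_space)

lemma measurable_borel_probs:
  assumes "M \<in> borel_probs K" "f \<in> borel_measurable borel"
  shows "f \<in> borel_measurable M"
proof -
  have "f \<in> borel_measurable (restrict_space borel K)" by (rule measurable_restrict_space1[OF assms(2)])
  then show ?thesis using assms(1) by (simp add: borel_probs_iff cong: measurable_cong_sets)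
qed

lemma distr_borel_probs:
  assumes "M \<in> borel_probs K" "f \<in> K \<rightarrow> L" "f \<in> borel_measurable M"
  shows "distr M (restrict_space borel L) f \<in> borel_probs L"
    and "f \<in> M \<rightarrow>\<^sub>M restrict_space borel L"
proof -
  show "f \<in> M \<rightarrow>\<^sub>M restrict_space borel L"
    using assms space_borel_probs[OF assms(1)] by (intro measurable_restrict_space2) auto
  then show "distr M (restrict_space borel L) f \<in> borel_probs L"
    using assms(1) by (simp add: borel_probs_iff prob_space.prob_space_distr)
qed

lemma integrable_borel_probs:
  fixes f :: "'b::euclidean_space \<Rightarrow> 'c::{banach, second_countable_topology}"
  assumes "M \<in> borel_probs K" "compact K" "continuous_on UNIV f"
  shows "integrable M f"
proof -
  interpret prob_space M using assms(1) by (simp add: borel_probs_iff)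
  have "compact (f ` K)"
    by (intro compact_continuous_image continuous_on_subset[OF assms(3)] assms) auto
  then obtain B where "\<forall>x\<in>K. norm (f x) \<le> B"
    by (auto dest!: compact_imp_bounded simp: bounded_iff)
  then show ?thesis
    using measurable_borel_probs[OF assms(1)] borel_measurable_continuous_onI[OF assms(3)]
      space_borel_probs[OF assms(1)]
    by (intro integrable_const_bound[of _ B]) auto
qed

text \<open>The test functions are continuous on the whole space instead of on a set \<open>K\<close> that carries the
  measures. For compact \<open>K\<close> this is the usual notion: by Tietze's theorem the restrictions to \<open>K\<close>
  are all continuous functions on \<open>K\<close>, and they are bounded there.\<close>

definition weakly_converges :: "(nat \<Rightarrow> 'b::topological_space measure) \<Rightarrow> 'b measure \<Rightarrow> bool" where
  "weakly_converges M L \<longleftrightarrow>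
     (\<forall>\<phi> :: 'b \<Rightarrow> real. continuous_on UNIV \<phi> \<longrightarrow> (\<lambda>n. \<integral>x. \<phi> x \<partial>M n) \<longlonglongrightarrow> (\<integral>x. \<phi> x \<partial>L))"

lemma weakly_convergesD:
  fixes \<phi> :: "'b::topological_space \<Rightarrow> real"
  assumes "weakly_converges M L" "continuous_on UNIV \<phi>"
  shows "(\<lambda>n. \<integral>x. \<phi> x \<partial>M n) \<longlonglongrightarrow> (\<integral>x. \<phi> x \<partial>L)"
  using assms by (simp add: weakly_converges_def)

lemma weakly_converges_const: "weakly_converges (\<lambda>_. M) M"
  by (simp add: weakly_converges_def)

lemma weakly_converges_subseq:
  "weakly_converges M L \<Longrightarrow> strict_mono r \<Longrightarrow> weakly_converges (M \<circ> r) L"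
  unfolding weakly_converges_def using LIMSEQ_subseq_LIMSEQ by (fastforce simp: o_def)

lemma weakly_converges_distr:
  fixes f :: "'b::euclidean_space \<Rightarrow> 'c::euclidean_space"
  assumes "weakly_converges M L" "continuous_on UNIV f"
    and "\<And>n. M n \<in> borel_probs K" "L \<in> borel_probs K" "f ` K \<subseteq> A"
  shows "weakly_converges (\<lambda>n. distr (M n) (restrict_space borel A) f) (distr L (restrict_space borel A) f)"
  unfolding weakly_converges_def
proof (intro allI impI)
  fix \<phi> :: "'c \<Rightarrow> real" assume \<phi>: "continuous_on UNIV \<phi>"
  have f: "f \<in> N \<rightarrow>\<^sub>M restrict_space borel A" if "N \<in> borel_probs K" for N
    using assms(5) measurable_borel_probs[OF that borel_measurable_continuous_onI[OF assms(2)]]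
    by (intro distr_borel_probs(2)[OF that]) auto
  have \<phi>m: "\<phi> \<in> borel_measurable (restrict_space borel A)"
    by (intro measurable_restrict_space1 borel_measurable_continuous_onI \<phi>)
  have "continuous_on UNIV (\<lambda>x. \<phi> (f x))"
    using \<phi> assms(2) by (rule continuous_on_compose2) auto
  from weakly_convergesD[OF assms(1) this]
  show "(\<lambda>n. \<integral>x. \<phi> x \<partial>distr (M n) (restrict_space borel A) f)
      \<longlonglongrightarrow> (\<integral>x. \<phi> x \<partial>distr L (restrict_space borel A) f)"
    by (simp add: integral_distr[OF f[OF assms(3)] \<phi>m] integral_distr[OF f[OF assms(4)] \<phi>m])
qed

text \<open>Closed sets generate the Borel sets and are stable under intersection, and the indicator of a
  closed set is the limit of continuous functions of the distance to it.\<close>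

lemma finite_measure_eqI_continuous:
  fixes M :: "'b::euclidean_space measure"
  assumes sets: "sets M = sets (restrict_space borel K)" "sets L = sets (restrict_space borel K)"
    and fin: "finite_measure M" "finite_measure L"
    and eq: "\<And>\<phi> :: 'b \<Rightarrow> real. continuous_on UNIV \<phi> \<Longrightarrow> (\<And>x. 0 \<le> \<phi> x \<and> \<phi> x \<le> 1)
      \<Longrightarrow> (\<integral>x. \<phi> x \<partial>M) = (\<integral>x. \<phi> x \<partial>L)"
  shows "M = L"
proof -
  have sp: "space M = K" "space L = K"
    using sets_eq_imp_space_eq[OF sets(1)] sets_eq_imp_space_eq[OF sets(2)] by (auto simp: space_restrict_space)
  have closed_eq: "emeasure M (C \<inter> K) = emeasure L (C \<inter> K)" if C: "closed C" for C
  proof (cases "C = {}")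
    case False
    define \<phi> where "\<phi> n x = max 0 (1 - real n * infdist x C)" for n x
    have cont: "continuous_on UNIV (\<phi> n)" for n
      unfolding \<phi>_def by (intro continuous_intros)
    have bound: "0 \<le> \<phi> n x \<and> \<phi> n x \<le> 1" for n x
      by (auto simp: \<phi>_def infdist_nonneg)
    have lim: "(\<lambda>n. \<phi> n x) \<longlonglongrightarrow> indicator C x" for x
    proof (cases "x \<in> C")
      case False
      then have pos: "infdist x C > 0"
        using in_closed_iff_infdist_zero[OF C \<open>C \<noteq> {}\<close>] infdist_nonneg[of x C] by (auto simp: less_le)
      obtain m where m: "1 < real m * infdist x C" using reals_Archimedean3[OF pos] by blast
      have "\<phi> n x = 0" if "n \<ge> m" for n
      proof -
        have "real m * infdist x C \<le> real n * infdist x C" using pos that by (intro mult_right_mono) auto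
        then show ?thesis using m by (simp add: \<phi>_def)
      qed
      then show ?thesis using False
        by (intro tendsto_eventually) (auto simp: eventually_at_top_linorder)
    qed (simp add: \<phi>_def)
    have "(\<lambda>n. \<integral>x. \<phi> n x \<partial>N) \<longlonglongrightarrow> measure N (C \<inter> K)"
      if N: "sets N = sets (restrict_space borel K)" "finite_measure N" for N
    proof -
      interpret finite_measure N by fact
      have meas: "f \<in> borel_measurable N" if "f \<in> borel_measurable borel" for f :: "'b \<Rightarrow> real"
        using measurable_restrict_space1[OF that, of K] N(1) by (simp cong: measurable_cong_sets)
      have "(\<lambda>n. \<integral>x. \<phi> n x \<partial>N) \<longlonglongrightarrow> (\<integral>x. indicator C x \<partial>N)"
      proof (rule integral_dominated_convergence[where w = "\<lambda>_. 1"])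
        show "\<phi> n \<in> borel_measurable N" for n
          by (intro meas borel_measurable_continuous_onI cont)
        show "(indicator C :: 'b \<Rightarrow> real) \<in> borel_measurable N"
          by (intro meas borel_measurable_indicator[OF borel_closed[OF C]])
        show "AE x in N. norm (\<phi> n x) \<le> 1" for n using bound by simp
      qed (use lim in auto)
      moreover have "space N = K" using sets_eq_imp_space_eq[OF N(1)] by (simp add: space_restrict_space)
      ultimately show ?thesis by (simp)
    qed
    from LIMSEQ_unique[OF this[OF sets(1) fin(1)]] this[OF sets(2) fin(2)] eq[OF cont bound]
    have "measure M (C \<inter> K) = measure L (C \<inter> K)" by auto
    then show ?thesis
      by (simp add: finite_measure.emeasure_eq_measure[OF fin(1)] finite_measure.emeasure_eq_measure[OF fin(2)])
  qed simp
  have id: "id \<in> M \<rightarrow>\<^sub>M borel" "id \<in> L \<rightarrow>\<^sub>M borel"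
    using sets by (auto simp: measurable_cong_sets[OF sets(1) refl] measurable_cong_sets[OF sets(2) refl]
        intro!: measurable_restrict_space1)
  have borel_eq: "distr M borel id = distr L borel id"
  proof (rule measure_eqI_generator_eq[where E = "{C. closed C}" and \<Omega> = UNIV and A = "\<lambda>_. UNIV"])
    show "Int_stable {C::'b set. closed C}" by (auto simp: Int_stable_def)
    show "sets (distr M borel id) = sigma_sets UNIV {C. closed C}"
      "sets (distr L borel id) = sigma_sets UNIV {C. closed C}"
      by (simp_all add: borel_eq_closed)
    show "emeasure (distr M borel id) X = emeasure (distr L borel id) X" if "X \<in> {C. closed C}" for X
      using that closed_eq[of X] id by (simp add: emeasure_distr sp)
    show "emeasure (distr M borel id) UNIV \<noteq> \<infinity>" for i :: nat
      using id finite_measure.emeasure_finite[OF fin(1)] by (simp add: emeasure_distr)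
  qed auto
  show ?thesis
  proof (rule measure_eqI)
    show "sets M = sets L" using sets by simp
    fix A assume "A \<in> sets M"
    then obtain B where B: "B \<in> sets borel" "A = K \<inter> B" using sets by (auto simp: sets_restrict_space)
    have "emeasure (distr M borel id) B = emeasure (distr L borel id) B" by (simp add: borel_eq)
    then show "emeasure M A = emeasure L A"
      using B id by (simp add: emeasure_distr sp Int_commute)
  qed
qed

lemma weakly_converges_unique:
  fixes M :: "nat \<Rightarrow> 'b::euclidean_space measure"
  assumes "weakly_converges M L" "weakly_converges M L'" "L \<in> borel_probs K" "L' \<in> borel_probs K"
  shows "L = L'"
proof (rule finite_measure_eqI_continuous[of _ K])
  show "(\<integral>x. \<phi> x \<partial>L) = (\<integral>x. \<phi> x \<partial>L')" if "continuous_on UNIV \<phi>" for \<phi> :: "'b \<Rightarrow> real"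
    using that assms LIMSEQ_unique weakly_convergesD by blast
qed (use assms in \<open>auto simp: borel_probs_iff prob_space_def\<close>)

text \<open>Helly's selection theorem, with two additions: the limit is carried by \<open>C\<close>, because the truncated
  distance to \<open>C\<close> is a test function whose integrals along the sequence vanish; and by Tietze's
  theorem the convergence extends to functions that are continuous only on \<open>C\<close>.\<close>

lemma weakly_compact_reals:
  fixes P :: "nat \<Rightarrow> real measure"
  assumes C: "compact C" and P: "\<And>n. real_distribution (P n)" "\<And>n. AE t in P n. t \<in> C"
  obtains r Q where "strict_mono r" "real_distribution Q" "AE t in Q. t \<in> C"
    "\<And>\<phi> :: real \<Rightarrow> real. continuous_on C \<phi> \<Longrightarrow>
      (\<lambda>n. \<integral>t. (if t \<in> C then \<phi> t else 0) \<partial>P (r n)) \<longlonglongrightarrow> (\<integral>t. (if t \<in> C then \<phi> t else 0) \<partial>Q)"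
proof -
  obtain R where R: "R > 0" "\<And>t. t \<in> C \<Longrightarrow> norm t < R"
    using compact_imp_bounded[OF C] unfolding bounded_pos_less by blast
  have "measure (P n) {- R<..R} = 1" for n
  proof -
    interpret real_distribution "P n" by fact
    have "AE t in P n. t \<in> {- R<..R}"
      using P(2)[of n] by eventually_elim (use R(2) in force)
    then show ?thesis by (subst prob_eq_1) auto
  qed
  then have "tight P"
    unfolding tight_def using P(1) R(1) by (intro conjI allI impI exI[of _ "- R"] exI[of _ R]) auto
  from tight_imp_convergent_subsubsequence[OF this strict_mono_id]
  obtain r Q where r: "strict_mono r" and Q: "real_distribution Q" and conv: "weak_conv_m (P \<circ> r) Q"
    by auto
  interpret Q: real_distribution Q by fact
  have lim: "(\<lambda>n. \<integral>t. f t \<partial>P (r n)) \<longlonglongrightarrow> (\<integral>t. f t \<partial>Q)"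
    if "continuous_on UNIV f" "\<And>t. norm (f t) \<le> B" for f :: "real \<Rightarrow> real" and B
    using weak_conv_imp_integral_bdd_continuous_conv[of "P \<circ> r" Q f B] that P(1) Q conv
    by (simp add: continuous_on_eq_continuous_at)
  have ne: "C \<noteq> {}"
  proof
    assume "C = {}"
    interpret real_distribution "P 0" by (rule P(1))
    show False using P(2)[of 0] \<open>C = {}\<close> by (simp add: AE_False)
  qed
  define d where "d t = min 1 (infdist t C)" for t
  have d: "continuous_on UNIV d" "\<And>t. norm (d t) \<le> 1" "\<And>t. 0 \<le> d t"
    unfolding d_def by (intro continuous_intros) (auto simp: infdist_nonneg min_def abs_le_iff)
  have [measurable]: "d \<in> borel_measurable borel" by (rule borel_measurable_continuous_onI[OF d(1)])
  have "(\<integral>t. d t \<partial>P (r n)) = 0" for n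
  proof (rule integral_eq_zero_AE)
    show "AE t in P (r n). d t = 0" using P(2)[of "r n"] by eventually_elim (simp add: d_def)
  qed
  then have "(\<lambda>_. 0) \<longlonglongrightarrow> (\<integral>t. d t \<partial>Q)" using lim[OF d(1,2)] by simp
  then have "(\<integral>t. d t \<partial>Q) = 0" by (simp add: LIMSEQ_const_iff)
  then have "AE t in Q. d t = 0"
    using integral_nonneg_eq_0_iff_AE[of Q d] d Q.integrable_const_bound[of d 1] by simp
  then have Q_C: "AE t in Q. t \<in> C"
  proof eventually_elim
    case (elim t)
    then show "t \<in> C"
      using in_closed_iff_infdist_zero[OF compact_imp_closed[OF C] ne, of t] by (auto simp: d_def min_def split: if_splits)
  qed
  have "(\<lambda>n. \<integral>t. (if t \<in> C then \<phi> t else 0) \<partial>P (r n)) \<longlonglongrightarrow> (\<integral>t. (if t \<in> C then \<phi> t else 0) \<partial>Q)"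
    if \<phi>: "continuous_on C \<phi>" for \<phi> :: "real \<Rightarrow> real"
  proof -
    have "bounded (\<phi> ` C)" using compact_continuous_image[OF \<phi> C] by (rule compact_imp_bounded)
    then obtain B where B: "0 < B" "\<And>t. t \<in> C \<Longrightarrow> norm (\<phi> t) \<le> B"
      unfolding bounded_pos by auto
    obtain f where f: "continuous_on UNIV f" "\<And>t. t \<in> C \<Longrightarrow> f t = \<phi> t" "\<And>t. norm (f t) \<le> B"
      using Tietze[OF \<phi>, of UNIV B] B compact_imp_closed[OF C] by (auto simp: closed_closedin[symmetric])
    have [measurable]: "f \<in> borel_measurable borel" "C \<in> sets borel"
      using borel_measurable_continuous_onI[OF f(1)] compact_imp_closed[OF C] by auto
    have eq: "(\<integral>t. (if t \<in> C then \<phi> t else 0) \<partial>N) = (\<integral>t. f t \<partial>N)"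
      if N: "real_distribution N" "AE t in N. t \<in> C" for N
    proof -
      interpret real_distribution N by fact
      have "(\<integral>t. (if t \<in> C then \<phi> t else 0) \<partial>N) = (\<integral>t. (if t \<in> C then f t else 0) \<partial>N)"
        by (intro Bochner_Integration.integral_cong) (auto simp: f(2))
      also have "\<dots> = (\<integral>t. f t \<partial>N)"
      proof (rule integral_cong_AE)
        show "AE t in N. (if t \<in> C then f t else 0) = f t" using N(2) by eventually_elim simp
      qed auto
      finally show ?thesis .
    qed
    show ?thesis unfolding eq[OF Q Q_C] eq[OF P] by (rule lim[OF f(1,3)])
  qed
  with r Q Q_C show ?thesis by (rule that)
qed

text \<open>The measures are moved to a compact set of reals by a Borel right inverse \<open>s\<close> of a continuous
  surjection \<open>g\<close>, and the limit is moved back by \<open>g\<close>. Only \<open>g\<close> has to be continuous: a test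
  function \<open>\<phi>\<close> on \<open>K\<close> becomes \<open>\<phi> \<circ> g\<close>, and \<open>\<phi> \<circ> g \<circ> s = \<phi>\<close>.\<close>

theorem weakly_compact_borel_probs:
  fixes K :: "'b::euclidean_space set" and M :: "nat \<Rightarrow> 'b measure"
  assumes K: "compact K" and M: "\<And>n. M n \<in> borel_probs K"
  obtains r L where "strict_mono r" "L \<in> borel_probs K" "weakly_converges (M \<circ> r) L"
proof -
  obtain C :: "real set" and g where C: "compact C" "continuous_on C g" "g ` C = K"
    by (rule compact_imp_continuous_image_of_compact_reals[OF K])
  obtain s where s: "s \<in> borel_measurable (restrict_space borel K)" "\<And>x. x \<in> K \<Longrightarrow> s x \<in> C \<and> g (s x) = x"
    using measurable_right_inverse_compact[OF C] by blast
  have C_borel [measurable]: "C \<in> sets borel" using compact_imp_closed[OF C(1)] by auto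
  have sM [measurable]: "s \<in> borel_measurable (M n)" for n
    using s(1) M[of n] by (simp add: borel_probs_iff cong: measurable_cong_sets)
  obtain x0 where x0: "x0 \<in> K"
  proof -
    interpret prob_space "M 0" using M[of 0] by (simp add: borel_probs_iff)
    show ?thesis using that not_empty space_borel_probs[OF M[of 0]] by auto
  qed
  define P where "P n = distr (M n) borel s" for n
  have P: "real_distribution (P n)" for n
  proof -
    interpret prob_space "M n" using M[of n] by (simp add: borel_probs_iff)
    show ?thesis unfolding P_def by (simp add: prob_space.prob_space_distr prob_space_axioms real_distribution_def real_distribution_axioms_def prob_space_distr)
  qed
  have P_C: "AE t in P n. t \<in> C" for n
    unfolding P_def by (subst AE_distr_iff) (use s(2) space_borel_probs[OF M] in auto)
  obtain r Q where r: "strict_mono r" and Q: "real_distribution Q" "AE t in Q. t \<in> C"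
    and lim: "\<And>\<phi> :: real \<Rightarrow> real. continuous_on C \<phi> \<Longrightarrow>
      (\<lambda>n. \<integral>t. (if t \<in> C then \<phi> t else 0) \<partial>P (r n)) \<longlonglongrightarrow> (\<integral>t. (if t \<in> C then \<phi> t else 0) \<partial>Q)"
    by (rule weakly_compact_reals[where P = P, OF C(1) P P_C]) blast
  interpret Q: real_distribution Q by fact
  define h where "h t = (if t \<in> C then g t else x0)" for t
  have h: "h \<in> borel_measurable borel"
    unfolding h_def by (rule borel_measurable_continuous_on_if[OF C_borel C(2)]) auto
  have h_K: "h \<in> Q \<rightarrow>\<^sub>M restrict_space borel K"
    using h C(3) x0 by (intro measurable_restrict_space2) (auto simp: h_def cong: measurable_cong_sets)
  define L where "L = distr Q (restrict_space borel K) h"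
  have "L \<in> borel_probs K"
    unfolding L_def borel_probs_iff by (simp add: Q.prob_space_distr[OF h_K])
  moreover have "weakly_converges (M \<circ> r) L"
    unfolding weakly_converges_def
  proof (intro allI impI)
    fix \<phi> :: "'b \<Rightarrow> real" assume \<phi>: "continuous_on UNIV \<phi>"
    then have [measurable]: "\<phi> \<in> borel_measurable borel" by (rule borel_measurable_continuous_onI)
    have "continuous_on C (\<lambda>t. \<phi> (g t))" using \<phi> C(2) by (rule continuous_on_compose2) auto
    have cts: "(\<lambda>t. if t \<in> C then \<phi> (g t) else 0) \<in> borel_measurable borel"
      by (rule borel_measurable_continuous_on_if[OF C_borel \<open>continuous_on C (\<lambda>t. \<phi> (g t))\<close>]) auto
    have "(\<integral>t. (if t \<in> C then \<phi> (g t) else 0) \<partial>P n) = (\<integral>x. \<phi> x \<partial>M n)" for n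
    proof -
      have "(\<integral>t. (if t \<in> C then \<phi> (g t) else 0) \<partial>P n) = (\<integral>x. (if s x \<in> C then \<phi> (g (s x)) else 0) \<partial>M n)"
        unfolding P_def by (rule integral_distr[OF sM cts])
      also have "\<dots> = (\<integral>x. \<phi> x \<partial>M n)"
        using s(2) space_borel_probs[OF M] by (intro Bochner_Integration.integral_cong) auto
      finally show ?thesis .
    qed
    moreover have "(\<integral>t. (if t \<in> C then \<phi> (g t) else 0) \<partial>Q) = (\<integral>x. \<phi> x \<partial>L)"
    proof -
      have "(\<integral>x. \<phi> x \<partial>L) = (\<integral>t. \<phi> (h t) \<partial>Q)"
        unfolding L_def by (intro integral_distr h_K measurable_restrict_space1) auto
      also have "\<dots> = (\<integral>t. (if t \<in> C then \<phi> (g t) else 0) \<partial>Q)"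
      proof (rule integral_cong_AE)
        show "AE t in Q. \<phi> (h t) = (if t \<in> C then \<phi> (g t) else 0)"
          using Q(2) by eventually_elim (simp add: h_def)
      qed (use cts h in auto)
      finally show ?thesis by simp
    qed
    ultimately show "(\<lambda>n. \<integral>x. \<phi> x \<partial>(M \<circ> r) n) \<longlonglongrightarrow> (\<integral>x. \<phi> x \<partial>L)"
      using lim[OF \<open>continuous_on C (\<lambda>t. \<phi> (g t))\<close>] by simp
  qed
  ultimately show ?thesis using r that by blast
qed

section \<open>Disintegration\<close>

lemma AE_le_if_set_integrals_le:
  fixes f g :: "'a \<Rightarrow> ennreal"
  assumes [measurable]: "f \<in> borel_measurable M" "g \<in> borel_measurable M"
    and le: "\<And>A. A \<in> sets M \<Longrightarrow> (\<integral>\<^sup>+x. f x * indicator A x \<partial>M) \<le> (\<integral>\<^sup>+x. g x * indicator A x \<partial>M)"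
    and fin: "(\<integral>\<^sup>+x. g x \<partial>M) < \<infinity>"
  shows "AE x in M. f x \<le> g x"
proof -
  define A where "A = {x \<in> space M. g x < f x}"
  have [measurable]: "A \<in> sets M" unfolding A_def by measurable
  have finA: "(\<integral>\<^sup>+x. g x * indicator A x \<partial>M) < \<infinity>"
    by (rule le_less_trans[OF nn_integral_mono fin]) (auto simp: indicator_def)
  have "(\<integral>\<^sup>+x. f x * indicator A x - g x * indicator A x \<partial>M)
      = (\<integral>\<^sup>+x. f x * indicator A x \<partial>M) - (\<integral>\<^sup>+x. g x * indicator A x \<partial>M)"
    using finA by (intro nn_integral_diff AE_I2) (auto simp: A_def indicator_def)
  also have "\<dots> = 0" using le[of A] finA by (simp add: diff_eq_0_iff_ennreal)
  finally have "AE x in M. f x * indicator A x - g x * indicator A x = 0"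
    by (subst (asm) nn_integral_0_iff_AE) auto
  with AE_space show ?thesis
  proof eventually_elim
    case (elim x)
    then show ?case
      by (cases "x \<in> A") (auto simp: A_def not_less diff_eq_0_iff_ennreal less_top)
  qed
qed

lemma incseq_rat_approximation_below:
  fixes t :: real
  obtains q :: "nat \<Rightarrow> rat" where "incseq q" "\<And>n. of_rat (q n) < t" "\<And>r. r < t \<Longrightarrow> \<exists>n. r < of_rat (q n)"
proof -
  define q :: "nat \<Rightarrow> rat" where "q n = of_int (\<lceil>t * 2 ^ n\<rceil> - 1) / 2 ^ n" for n
  have q: "real_of_rat (q n) = of_int (\<lceil>t * 2 ^ n\<rceil> - 1) / 2 ^ n" for n
    by (simp add: q_def of_rat_divide of_rat_diff of_rat_power)
  have "of_rat (q n) < t" for n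
  proof -
    have "of_int (\<lceil>t * 2 ^ n\<rceil> - 1) < t * 2 ^ n" by linarith
    then show ?thesis unfolding q by (simp add: pos_divide_less_eq)
  qed
  moreover have "incseq q"
  proof (rule incseq_SucI)
    fix n
    have "2 * (\<lceil>t * 2 ^ n\<rceil> - 1) \<le> \<lceil>2 * (t * 2 ^ n)\<rceil> - 1"
      unfolding zle_diff1_eq less_ceiling_iff by (simp, linarith)
    then have "(of_int (2 * (\<lceil>t * 2 ^ n\<rceil> - 1)) :: rat) \<le> of_int (\<lceil>t * 2 ^ Suc n\<rceil> - 1)"
      by (simp only: of_int_le_iff) (simp add: mult.left_commute)
    then have "(of_int (2 * (\<lceil>t * 2 ^ n\<rceil> - 1)) :: rat) / 2 ^ Suc n \<le> of_int (\<lceil>t * 2 ^ Suc n\<rceil> - 1) / 2 ^ Suc n"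
      by (intro divide_right_mono) auto
    moreover have "(of_int (2 * (\<lceil>t * 2 ^ n\<rceil> - 1)) :: rat) / 2 ^ Suc n = q n"
      unfolding q_def by (simp only: of_int_mult of_int_numeral power_Suc mult_divide_mult_cancel_left_if)
        simp
    ultimately show "q n \<le> q (Suc n)" unfolding q_def by simp
  qed
  moreover have "\<exists>n. r < of_rat (q n)" if "r < t" for r
  proof -
    obtain n where n: "(1 / 2) ^ n < t - r"
      using real_arch_pow_inv[of "t - r" "1 / 2"] \<open>r < t\<close> by auto
    have "(t * 2 ^ n - 1) / 2 ^ n \<le> of_int (\<lceil>t * 2 ^ n\<rceil> - 1) / 2 ^ n"
      by (intro divide_right_mono) (linarith, simp)
    then have "t - (1 / 2) ^ n \<le> of_rat (q n)" unfolding q by (simp add: diff_divide_distrib power_one_over)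
    with n show ?thesis by (intro exI[of _ n]) linarith
  qed
  ultimately show ?thesis using that by blast
qed

lemma sets_pair_lessThan_generator:
  fixes N :: "'a measure"
  defines "E \<equiv> {A \<times> B | A B. A \<in> sets N \<and> B \<in> range (lessThan :: real \<Rightarrow> real set)}"
  shows "sets (N \<Otimes>\<^sub>M (borel :: real measure)) = sigma_sets (space N \<times> UNIV) E"
    and "Int_stable E" and "E \<subseteq> Pow (space N \<times> UNIV)"
proof -
  show E: "E \<subseteq> Pow (space N \<times> UNIV)" unfolding E_def using sets.sets_into_space by fastforce
  have "sets (N \<Otimes>\<^sub>M (borel :: real measure)) = sets (sigma (space N \<times> space (borel :: real measure)) E)"
    unfolding E_def
  proof (rule sets_pair_eq)
    show "countable {space N}" "countable (range (\<lambda>n::nat. {..<real n}))" by auto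
    show "\<Union>(range (\<lambda>n::nat. {..<real n})) = space borel"
      using reals_Archimedean2 by auto
    show "sets (borel :: real measure) = sigma_sets (space borel) (range lessThan)"
      by (subst borel_Iio) simp
  qed (auto simp: sets.sigma_sets_eq dest: sets.sets_into_space)
  then show "sets (N \<Otimes>\<^sub>M (borel :: real measure)) = sigma_sets (space N \<times> UNIV) E"
    using E by simp
  show "Int_stable E"
    unfolding Int_stable_def
  proof (intro ballI)
    fix Y Z assume "Y \<in> E" "Z \<in> E"
    then obtain A s B t where "Y = A \<times> {..<s}" "Z = B \<times> {..<t}" "A \<in> sets N" "B \<in> sets N"
      by (auto simp: E_def)
    moreover have "(A \<times> {..<s}) \<inter> (B \<times> {..<t}) = (A \<inter> B) \<times> {..<min s t}" by auto
    ultimately show "Y \<inter> Z \<in> E" by (auto simp: E_def)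
  qed
qed

text \<open>The Radon-Nikodym densities \<open>f q\<close> of \<open>A \<mapsto> P (A \<times> {..q})\<close>, for rational \<open>q\<close>, are the conditional
  distribution functions of the second coordinate given the first, but \<open>q \<mapsto> f q x\<close> is a
  distribution function only for almost every \<open>x\<close>. Therefore the kernel at \<open>x\<close> is defined as the law
  of the quantile function \<open>u \<mapsto> inf {q. u < f q x}\<close> of a uniform random variable: this is a
  probability measure for every \<open>x\<close>, it is measurable in \<open>x\<close> because the infimum is countable, and
  for almost every \<open>x\<close> it gives \<open>{..<t}\<close> the mass \<open>sup {f q x | q < t}\<close>.\<close>

theorem disintegration_bounded_real:
  fixes P :: "('a \<times> real) measure"
  assumes P_sets [measurable_cong]: "sets P = sets (N \<Otimes>\<^sub>M borel)" and "prob_space P"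
    and supp: "AE z in P. snd z \<in> {a..b}"
  obtains \<kappa> where "\<kappa> \<in> N \<rightarrow>\<^sub>M prob_algebra borel"
    "\<And>Z. Z \<in> sets (N \<Otimes>\<^sub>M borel) \<Longrightarrow>
      emeasure P Z = (\<integral>\<^sup>+x. emeasure (\<kappa> x) (Pair x -` Z) \<partial>distr P N fst)"
proof -
  interpret P: prob_space P by fact
  have P_space: "space P = space N \<times> UNIV"
    using sets_eq_imp_space_eq[OF P_sets] by (simp add: space_pair_measure)
  have fst_P [measurable]: "fst \<in> P \<rightarrow>\<^sub>M N" by measurable
  have snd_P [measurable]: "snd \<in> borel_measurable P" by measurable
  have rect [measurable]: "A \<times> B \<in> sets P" if "A \<in> sets N" "B \<in> sets borel" for A B
    using that by (simp add: P_sets)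
  define \<nu> where "\<nu> = distr P N fst"
  interpret \<nu>: prob_space \<nu> unfolding \<nu>_def by (rule P.prob_space_distr) measurable
  have \<nu>_sets [measurable_cong, simp]: "sets \<nu> = sets N" by (simp add: \<nu>_def)
  have \<nu>_space [simp]: "space \<nu> = space N" by (simp add: \<nu>_def)
  have \<nu>_emeasure: "emeasure \<nu> A = emeasure P (A \<times> UNIV)" if "A \<in> sets N" for A
  proof -
    have "fst -` A \<inter> space P = A \<times> UNIV" using sets.sets_into_space[OF that] by (auto simp: P_space)
    then show ?thesis using that by (simp add: \<nu>_def emeasure_distr)
  qed
  have "a \<le> b"
  proof -
    have "\<not> (AE z in P. False)" using P.AE_False by simp
    then show ?thesis using supp by (cases "a \<le> b") auto
  qed

  define H where "H q = space N \<times> {..real_of_rat q}" for q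
  have [measurable]: "H q \<in> sets P" for q unfolding H_def by measurable
  define \<nu>q where "\<nu>q q = distr (density P (indicator (H q))) N fst" for q
  have \<nu>q: "emeasure (\<nu>q q) A = emeasure P (A \<times> {..of_rat q})" if A: "A \<in> sets N" for q A
  proof -
    have "emeasure (\<nu>q q) A = (\<integral>\<^sup>+z. indicator (H q) z * indicator (fst -` A \<inter> space P) z \<partial>P)"
      using A by (simp add: \<nu>q_def emeasure_distr emeasure_density)
    also have "\<dots> = (\<integral>\<^sup>+z. indicator (A \<times> {..of_rat q}) z \<partial>P)"
      using sets.sets_into_space[OF A] by (intro nn_integral_cong) (auto simp: H_def indicator_def P_space split: if_splits)
    finally show ?thesis using A by simp
  qed
  define f where "f q = RN_deriv \<nu> (\<nu>q q)" for q
  have [measurable]: "f q \<in> borel_measurable N" for q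
    using borel_measurable_RN_deriv[of \<nu> "\<nu>q q"] unfolding f_def by (simp cong: measurable_cong_sets)
  have f_int: "(\<integral>\<^sup>+x. f q x * indicator A x \<partial>\<nu>) = emeasure P (A \<times> {..of_rat q})" if A: "A \<in> sets N" for q A
  proof -
    have "absolutely_continuous \<nu> (\<nu>q q)"
      unfolding absolutely_continuous_def
    proof
      fix A assume "A \<in> null_sets \<nu>"
      then have A: "A \<in> sets N" "emeasure P (A \<times> UNIV) = 0" by (auto simp: null_sets_def \<nu>_emeasure)
      have "emeasure P (A \<times> {..of_rat q}) \<le> emeasure P (A \<times> UNIV)"
        using A by (intro emeasure_mono) auto
      then show "A \<in> null_sets (\<nu>q q)" using A \<nu>q[OF A(1), of q] by (auto simp: null_sets_def \<nu>q_def)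
    qed
    then have "density \<nu> (f q) = \<nu>q q"
      unfolding f_def by (rule \<nu>.density_RN_deriv) (simp add: \<nu>q_def)
    then have "emeasure (density \<nu> (f q)) A = emeasure P (A \<times> {..of_rat q})" using \<nu>q[OF A] by simp
    then show ?thesis using A by (simp add: emeasure_density)
  qed
  have f_fin: "(\<integral>\<^sup>+x. f q x \<partial>\<nu>) < \<infinity>" for q
  proof -
    have "(\<integral>\<^sup>+x. f q x \<partial>\<nu>) = (\<integral>\<^sup>+x. f q x * indicator (space N) x \<partial>\<nu>)"
      by (intro nn_integral_cong) auto
    then show ?thesis using f_int[of "space N" q] P.emeasure_finite by (simp add: less_top[symmetric])
  qed
  have "AE x in \<nu>. f q x \<le> f r x" if "q \<le> r" for q r
  proof (rule AE_le_if_set_integrals_le)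
    show "(\<integral>\<^sup>+x. f q x * indicator A x \<partial>\<nu>) \<le> (\<integral>\<^sup>+x. f r x * indicator A x \<partial>\<nu>)" if "A \<in> sets \<nu>" for A
      using that \<open>q \<le> r\<close> f_int[of A] by (auto intro!: emeasure_mono simp: of_rat_less_eq intro: order_trans)
  qed (use f_fin in auto)
  then have f_mono: "AE x in \<nu>. \<forall>q r. q \<le> r \<longrightarrow> f q x \<le> f r x"
    by (subst AE_all_countable, intro allI, subst AE_all_countable, intro allI) (auto intro: AE_impI)
  have "AE x in \<nu>. f q x \<le> 1" for q
  proof (rule AE_le_if_set_integrals_le)
    show "(\<integral>\<^sup>+x. f q x * indicator A x \<partial>\<nu>) \<le> (\<integral>\<^sup>+x. 1 * indicator A x \<partial>\<nu>)" if "A \<in> sets \<nu>" for A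
      using that f_int[of A q] \<nu>_emeasure[of A] by (auto intro!: emeasure_mono)
  qed (use \<nu>.emeasure_space_1 in auto)
  then have f_le1: "AE x in \<nu>. \<forall>q. f q x \<le> 1" by (subst AE_all_countable) auto

  \<comment> \<open>Clamping to \<open>[a, b]\<close> bounds the infimum from below; indices that do not qualify contribute the harmless value \<open>b\<close>.\<close>
  define X where "X x u = (INF q. if ennreal u < f q x then max a (min (of_rat q) b) else b)" for x and u :: real
  have X_less: "X x u < t \<longleftrightarrow> b < t \<or> (\<exists>q. ennreal u < f q x \<and> max a (min (of_rat q) b) < t)" for x u t
  proof -
    have "bdd_below (range (\<lambda>q. if ennreal u < f q x then max a (min (of_rat q) b) else b))"
      using \<open>a \<le> b\<close> by (intro bdd_belowI[of _ a]) auto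
    then have "X x u < t \<longleftrightarrow> (\<exists>q. (if ennreal u < f q x then max a (min (of_rat q) b) else b) < t)"
      unfolding X_def by (subst cINF_less_iff) auto
    moreover have "max a (min (of_rat q) b) < t" if "b < t" for q using \<open>a \<le> b\<close> that by simp
    ultimately show ?thesis by (auto split: if_splits)
  qed
  have X_meas [measurable]: "(\<lambda>(x, u). X x u) \<in> borel_measurable (N \<Otimes>\<^sub>M borel)"
  proof -
    have "(\<lambda>z. if ennreal (snd z) < f q (fst z) then max a (min (of_rat q) b) else b) \<in> borel_measurable (N \<Otimes>\<^sub>M borel)" for q
      by measurable
    then show ?thesis unfolding X_def split_beta' by (intro borel_measurable_cINF_real) auto
  qed
  define U where "U = uniform_measure lborel {0..1::real}"
  interpret U: prob_space U unfolding U_def by (rule prob_space_uniform_measure) auto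
  have [measurable_cong, simp]: "sets U = sets borel" "space U = UNIV" by (simp_all add: U_def)
  define \<kappa> where "\<kappa> x = distr U borel (X x)" for x
  have \<kappa> [measurable]: "\<kappa> \<in> N \<rightarrow>\<^sub>M prob_algebra borel"
    unfolding \<kappa>_def
    by (rule measurable_distr_prob_space2[where M = borel])
       (use X_meas U.prob_space_axioms in \<open>auto simp: space_prob_algebra\<close>)
  have Xx [measurable]: "X x \<in> borel_measurable borel" if "x \<in> space N" for x
    using measurable_Pair2[OF X_meas that] by simp
  have \<kappa>_lessThan: "emeasure (\<kappa> x) {..<t} = emeasure lborel {u \<in> {0..1}. X x u < t}" if "x \<in> space N" for x t
  proof -
    have "emeasure (\<kappa> x) {..<t} = emeasure U (X x -` {..<t})"
      using Xx[OF that] by (simp add: \<kappa>_def emeasure_distr cong: measurable_cong_sets)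
    also have "\<dots> = emeasure lborel ({0..1} \<inter> X x -` {..<t})"
      using Xx[OF that] measurable_sets[OF Xx[OF that], of "{..<t}"] by (simp add: U_def divide_ennreal_def)
    also have "{0..1} \<inter> X x -` {..<t} = {u \<in> {0..1}. X x u < t}" by auto
    finally show ?thesis .
  qed

  have rectangles: "(\<integral>\<^sup>+x. emeasure (\<kappa> x) {..<t} * indicator A x \<partial>\<nu>) = emeasure P (A \<times> {..<t})"
    if A: "A \<in> sets N" for A t
  proof -
    consider "t \<le> a" | "b < t" | "a < t" "t \<le> b" by linarith
    then show ?thesis
    proof cases
      case 1
      have "\<not> X x u < t" for x u using 1 \<open>a \<le> b\<close> by (auto simp: X_less)
      then have "(\<integral>\<^sup>+x. emeasure (\<kappa> x) {..<t} * indicator A x \<partial>\<nu>) = (\<integral>\<^sup>+x. 0 \<partial>\<nu>)"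
        by (intro nn_integral_cong) (simp add: \<kappa>_lessThan)
      moreover have "emeasure P (A \<times> {..<t}) = 0"
      proof (subst emeasure_eq_0_AE[symmetric])
        show "AE z in P. \<not> z \<in> A \<times> {..<t}"
          using supp by eventually_elim (use 1 in auto)
      qed (use A in \<open>auto intro!: arg_cong[where f = "emeasure P"] dest: sets.sets_into_space simp: P_space\<close>)
      ultimately show ?thesis by simp
    next
      case 2
      then have "{u \<in> {0..1}. X x u < t} = {0..1}" for x by (auto simp: X_less)
      then have "(\<integral>\<^sup>+x. emeasure (\<kappa> x) {..<t} * indicator A x \<partial>\<nu>) = (\<integral>\<^sup>+x. indicator A x \<partial>\<nu>)"
        by (intro nn_integral_cong) (simp add: \<kappa>_lessThan)
      also have "\<dots> = emeasure P (A \<times> UNIV)" using A \<nu>_emeasure by simp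
      also have "\<dots> = emeasure P (A \<times> {..<t})"
      proof (rule emeasure_eq_AE)
        show "AE z in P. z \<in> A \<times> UNIV \<longleftrightarrow> z \<in> A \<times> {..<t}"
          using supp by eventually_elim (use 2 in auto)
      qed (use A in auto)
      finally show ?thesis .
    next
      case 3
      obtain q :: "nat \<Rightarrow> rat" where q: "incseq q" "\<And>n. of_rat (q n) < t" "\<And>r. r < t \<Longrightarrow> \<exists>n. r < of_rat (q n)"
        using incseq_rat_approximation_below[of t] by blast
      have "AE x in \<nu>. emeasure (\<kappa> x) {..<t} * indicator A x = (SUP n. f (q n) x * indicator A x)"
        using f_mono f_le1 AE_space
      proof eventually_elim
        case (elim x)
        define S where "S = (SUP n. f (q n) x)"
        have "S \<le> 1" unfolding S_def using elim by (intro SUP_least) auto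
        then have "S < \<top>" using ennreal_one_less_top by (rule le_less_trans)
        then have S: "S = ennreal (enn2real S)" "enn2real S \<le> 1"
          using \<open>S \<le> 1\<close> by (auto intro: enn2real_leI)
        have "X x u < t \<longleftrightarrow> ennreal u < S" for u
        proof -
          have "X x u < t \<longleftrightarrow> (\<exists>r. ennreal u < f r x \<and> of_rat r < t)"
            using 3 by (auto simp: X_less min_def)
          also have "\<dots> \<longleftrightarrow> (\<exists>n. ennreal u < f (q n) x)"
          proof safe
            fix r assume r: "ennreal u < f r x" "of_rat r < t"
            then obtain n where "real_of_rat r < of_rat (q n)" using q(3) by blast
            then have "f r x \<le> f (q n) x" using elim by (auto simp: of_rat_less)
            with r show "\<exists>n. ennreal u < f (q n) x" by (auto intro: less_le_trans)
          qed (use q(2) in blast)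
          finally show ?thesis by (simp add: S_def less_SUP_iff)
        qed
        moreover have "ennreal u < S \<longleftrightarrow> u < enn2real S" if "0 \<le> u" for u
          using ennreal_less_iff[OF that, of "enn2real S"] S(1) by simp
        ultimately have "{u \<in> {0..1}. X x u < t} = {0..<enn2real S}"
          using S(2) by auto
        then have "emeasure (\<kappa> x) {..<t} = S"
          using elim S(1) by (simp add: \<kappa>_lessThan)
        then show ?case unfolding S_def by (simp add: SUP_mult_right_ennreal)
      qed
      then have "(\<integral>\<^sup>+x. emeasure (\<kappa> x) {..<t} * indicator A x \<partial>\<nu>)
          = (\<integral>\<^sup>+x. (SUP n. f (q n) x * indicator A x) \<partial>\<nu>)"
        by (rule nn_integral_cong_AE)
      also have "\<dots> = (SUP n. \<integral>\<^sup>+x. f (q n) x * indicator A x \<partial>\<nu>)"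
      proof (rule nn_integral_monotone_convergence_SUP_AE)
        show "AE x in \<nu>. f (q n) x * indicator A x \<le> f (q (Suc n)) x * indicator A x" for n
          using f_mono
        proof eventually_elim
          case (elim x)
          then show ?case using incseq_SucD[OF q(1), of n] by (auto intro: mult_right_mono)
        qed
      qed (use A in measurable)
      also have "\<dots> = (SUP n. emeasure P (A \<times> {..of_rat (q n)}))" by (simp add: f_int[OF A])
      also have "\<dots> = emeasure P (\<Union>n. A \<times> {..of_rat (q n)})"
      proof (rule SUP_emeasure_incseq)
        show "incseq (\<lambda>n. A \<times> {..real_of_rat (q n)})"
          using q(1) by (auto simp: incseq_def of_rat_less_eq intro: order_trans)
      qed (use A in auto)
      also have "(\<Union>n. A \<times> {..real_of_rat (q n)}) = A \<times> {..<t}"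
        using q(2,3) by (auto intro: le_less_trans less_imp_le) (meson less_imp_le)
      finally show ?thesis .
    qed
  qed

  \<comment> \<open>It remains to compare \<open>P\<close> with the measure built from \<open>\<nu>\<close> and \<open>\<kappa>\<close>, which agree on rectangles.\<close>
  define Q where "Q = \<nu> \<bind> (\<lambda>x. distr (\<kappa> x) (N \<Otimes>\<^sub>M borel) (Pair x))"
  have \<nu>_alg: "\<nu> \<in> space (prob_algebra N)" using \<nu>.prob_space_axioms by (simp add: space_prob_algebra)
  have kern: "(\<lambda>x. distr (\<kappa> x) (N \<Otimes>\<^sub>M borel) (Pair x)) \<in> N \<rightarrow>\<^sub>M prob_algebra (N \<Otimes>\<^sub>M borel)"
    by measurable
  have Q_sets: "sets Q = sets (N \<Otimes>\<^sub>M borel)" unfolding Q_def by (rule sets_bind'[OF \<nu>_alg kern])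
  have \<kappa>_sets: "sets (\<kappa> x) = sets borel" for x by (simp add: \<kappa>_def)
  have Q: "emeasure Q Z = (\<integral>\<^sup>+x. emeasure (\<kappa> x) (Pair x -` Z) \<partial>\<nu>)" if "Z \<in> sets (N \<Otimes>\<^sub>M borel)" for Z
    unfolding Q_def emeasure_bind_prob_algebra[OF \<nu>_alg kern that]
    using that sets_eq_imp_space_eq[OF \<kappa>_sets]
    by (intro nn_integral_cong) (simp add: emeasure_distr \<kappa>_sets measurable_cong_sets[OF \<kappa>_sets refl])
  have "P = Q"
  proof (rule measure_eqI_generator_eq[OF sets_pair_lessThan_generator(2,3)[of N]])
    show "emeasure P Z = emeasure Q Z"
      if Z: "Z \<in> {A \<times> B |A B. A \<in> sets N \<and> B \<in> range (lessThan :: real \<Rightarrow> real set)}" for Z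
    proof -
      obtain A t where A: "A \<in> sets N" "Z = A \<times> {..<t}" using Z by auto
      have "emeasure Q Z = (\<integral>\<^sup>+x. emeasure (\<kappa> x) {..<t} * indicator A x \<partial>\<nu>)"
        using A by (subst Q) (auto intro!: nn_integral_cong simp: indicator_def)
      then show ?thesis using rectangles[OF A(1)] A(2) by simp
    qed
    show "sets P = sigma_sets (space N \<times> UNIV) {A \<times> B |A B. A \<in> sets N \<and> B \<in> range (lessThan :: real \<Rightarrow> real set)}"
      "sets Q = sigma_sets (space N \<times> UNIV) {A \<times> B |A B. A \<in> sets N \<and> B \<in> range (lessThan :: real \<Rightarrow> real set)}"
      using sets_pair_lessThan_generator(1)[of N] P_sets Q_sets by simp_all
    show "range (\<lambda>n::nat. space N \<times> {..<real n}) \<subseteq> {A \<times> B |A B. A \<in> sets N \<and> B \<in> range (lessThan :: real \<Rightarrow> real set)}"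
      by auto
    show "(\<Union>n. space N \<times> {..<real n}) = space N \<times> UNIV" using reals_Archimedean2 by auto
  qed simp
  then have "emeasure P Z = (\<integral>\<^sup>+x. emeasure (\<kappa> x) (Pair x -` Z) \<partial>distr P N fst)"
    if "Z \<in> sets (N \<Otimes>\<^sub>M borel)" for Z
    using Q[OF that] unfolding \<nu>_def by simp
  with \<kappa> show ?thesis by (rule that)
qed

lemma sets_restrict_borel_Times:
  fixes A :: "'a::second_countable_topology set" and B :: "'b::second_countable_topology set"
  shows "sets (restrict_space borel (A \<times> B)) = sets (restrict_space borel A \<Otimes>\<^sub>M restrict_space borel B)"
    (is "sets ?R = sets ?P")
proof
  have sp: "space ?R = A \<times> B" "space ?P = A \<times> B"
    by (auto simp: space_restrict_space space_pair_measure)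
  have "fst \<in> ?R \<rightarrow>\<^sub>M restrict_space borel A" "snd \<in> ?R \<rightarrow>\<^sub>M restrict_space borel B"
    by (rule measurable_restrict_space2; use sp(1) in
        \<open>force intro: measurable_restrict_space1 borel_measurable_continuous_onI continuous_intros\<close>)+
  then have "id \<in> ?R \<rightarrow>\<^sub>M ?P" unfolding measurable_pair_iff by (simp add: comp_def)
  moreover have "id \<in> ?P \<rightarrow>\<^sub>M ?R"
  proof (rule measurable_restrict_space2)
    have "(\<lambda>z. id (fst z)) \<in> ?P \<rightarrow>\<^sub>M borel" "(\<lambda>z. id (snd z)) \<in> ?P \<rightarrow>\<^sub>M borel"
      by (rule measurable_compose[OF measurable_fst measurable_restrict_space1[OF measurable_ident]]
          measurable_compose[OF measurable_snd measurable_restrict_space1[OF measurable_ident]])+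
    then have "(\<lambda>z. (fst z, snd z)) \<in> ?P \<rightarrow>\<^sub>M borel \<Otimes>\<^sub>M borel" by (intro measurable_Pair) simp_all
    then show "id \<in> ?P \<rightarrow>\<^sub>M borel" by (simp add: borel_prod id_def)
  qed (simp add: sp)
  ultimately show "sets ?R \<subseteq> sets ?P" "sets ?P \<subseteq> sets ?R"
    by (auto dest!: measurable_sets dest: sets.sets_into_space simp: sp Int_absorb2)
qed

text \<open>The second coordinate is encoded by the reals \<open>s y\<close>, disintegrated there, and the resulting
  kernel is pushed back to \<open>\<Omega>\<close> by a left inverse \<open>h\<close> of \<open>s\<close>.\<close>

theorem is_disintegration_disintegration:
  assumes K: "compact \<Omega>" and \<gamma>: "\<gamma> \<in> borel_probs (\<Omega> \<times> \<Omega>)"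
  shows "is_disintegration \<Omega> \<gamma> (disintegration \<Omega> \<gamma>)"
proof -
  let ?N = "restrict_space borel \<Omega>"
  interpret prob_space \<gamma> using \<gamma> by (simp add: borel_probs_iff)
  have \<gamma>_sets [measurable_cong]: "sets \<gamma> = sets (?N \<Otimes>\<^sub>M ?N)"
    using \<gamma> by (simp add: borel_probs_iff sets_restrict_borel_Times)
  have \<gamma>_space: "space \<gamma> = \<Omega> \<times> \<Omega>" using \<gamma> by (rule space_borel_probs)
  obtain C :: "real set" and g where C: "compact C" "continuous_on C g" "g ` C = \<Omega>"
    by (rule compact_imp_continuous_image_of_compact_reals[OF K])
  obtain s where s [measurable]: "s \<in> borel_measurable ?N" and gs: "\<And>x. x \<in> \<Omega> \<Longrightarrow> s x \<in> C \<and> g (s x) = x"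
    using measurable_right_inverse_compact[OF C] by blast
  obtain R where R: "\<forall>t\<in>C. norm t \<le> R" using compact_imp_bounded[OF C(1)] unfolding bounded_iff by blast
  obtain x0 where x0: "x0 \<in> \<Omega>" using not_empty \<gamma>_space by auto
  \<comment> \<open>Off \<open>C\<close> the value is a dummy that keeps \<open>h\<close> inside \<open>\<Omega>\<close>, so that the pushed kernel is carried by \<open>\<Omega>\<close>.\<close>
  define h where "h t = (if t \<in> C then g t else x0)" for t
  have "C \<in> sets borel" using compact_imp_closed[OF C(1)] by auto
  then have "h \<in> borel_measurable borel"
    unfolding h_def by (intro borel_measurable_continuous_on_if C(2)) auto
  then have h [measurable]: "h \<in> borel \<rightarrow>\<^sub>M ?N"
    using C(3) x0 by (intro measurable_restrict_space2) (auto simp: h_def)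
  have hs: "h (s x) = x" if "x \<in> \<Omega>" for x using gs[OF that] by (simp add: h_def)

  define T where "T z = (fst z, s (snd z))" for z :: "'a \<times> 'a"
  have T [measurable]: "T \<in> \<gamma> \<rightarrow>\<^sub>M ?N \<Otimes>\<^sub>M borel" unfolding T_def by measurable
  define P where "P = distr \<gamma> (?N \<Otimes>\<^sub>M borel) T"
  have P: "prob_space P" unfolding P_def by (rule prob_space_distr) measurable
  have P_supp: "AE z in P. snd z \<in> {- R..R}"
    unfolding P_def using gs R
    by (subst AE_distr_iff) (auto simp: T_def \<gamma>_space abs_le_iff minus_le_iff intro!: AE_I2)
  have P_sets: "sets P = sets (?N \<Otimes>\<^sub>M borel)" by (simp add: P_def)
  obtain \<kappa> where \<kappa> [measurable]: "\<kappa> \<in> ?N \<rightarrow>\<^sub>M prob_algebra borel"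
    and P_eq: "\<And>Z. Z \<in> sets (?N \<Otimes>\<^sub>M borel) \<Longrightarrow>
      emeasure P Z = (\<integral>\<^sup>+x. emeasure (\<kappa> x) (Pair x -` Z) \<partial>distr P ?N fst)"
    using disintegration_bounded_real[OF P_sets P P_supp] by blast
  have P_fst: "distr P ?N fst = distr \<gamma> ?N fst"
    unfolding P_def by (subst distr_distr) (auto simp: comp_def T_def)
  define K where "K x = distr (\<kappa> x) ?N h" for x
  have K: "K \<in> ?N \<rightarrow>\<^sub>M prob_algebra ?N" unfolding K_def by measurable
  have "emeasure \<gamma> Z = (\<integral>\<^sup>+ x. (\<integral>\<^sup>+ y. indicator Z (x, y) \<partial>K x) \<partial>distr \<gamma> ?N fst)"
    if "Z \<in> sets (restrict_space borel (\<Omega> \<times> \<Omega>))" for Z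
  proof -
    have Z [measurable]: "Z \<in> sets (?N \<Otimes>\<^sub>M ?N)" using that by (simp add: sets_restrict_borel_Times)
    define H where "H z = (fst z, h (snd z))" for z :: "'a \<times> real"
    have H [measurable]: "H \<in> ?N \<Otimes>\<^sub>M borel \<rightarrow>\<^sub>M ?N \<Otimes>\<^sub>M ?N" unfolding H_def by measurable
    define Z' where "Z' = H -` Z \<inter> space (?N \<Otimes>\<^sub>M borel)"
    have Z': "Z' \<in> sets (?N \<Otimes>\<^sub>M borel)" unfolding Z'_def by measurable
    have "T -` Z' \<inter> space \<gamma> = Z"
    proof -
      have HT: "H (T z) = z" if "z \<in> space \<gamma>" for z using that hs by (auto simp: H_def T_def \<gamma>_space)
      have "Z \<subseteq> space \<gamma>" using sets.sets_into_space[of Z \<gamma>] Z \<gamma>_sets by simp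
      show ?thesis
      proof (intro set_eqI iffI)
        fix z assume "z \<in> T -` Z' \<inter> space \<gamma>"
        then show "z \<in> Z" using HT[of z] by (simp add: Z'_def)
      next
        fix z assume "z \<in> Z"
        then have "z \<in> space \<gamma>" using \<open>Z \<subseteq> space \<gamma>\<close> by (rule rev_subsetD)
        then show "z \<in> T -` Z' \<inter> space \<gamma>"
          using HT[of z] measurable_space[OF T, of z] \<open>z \<in> Z\<close> by (simp add: Z'_def)
      qed
    qed
    then have "emeasure \<gamma> Z = emeasure P Z'" unfolding P_def using Z' by (simp add: emeasure_distr[OF T])
    also have "\<dots> = (\<integral>\<^sup>+x. emeasure (\<kappa> x) (Pair x -` Z') \<partial>distr \<gamma> ?N fst)"
      unfolding P_eq[OF Z'] P_fst ..
    also have "\<dots> = (\<integral>\<^sup>+ x. (\<integral>\<^sup>+ y. indicator Z (x, y) \<partial>K x) \<partial>distr \<gamma> ?N fst)"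
    proof (rule nn_integral_cong)
      fix x assume "x \<in> space (distr \<gamma> ?N fst)"
      then have x: "x \<in> space ?N" by simp
      have \<kappa>x [measurable_cong]: "sets (\<kappa> x) = sets borel" using measurable_space[OF \<kappa> x] by (simp add: space_prob_algebra)
      have m: "h \<in> \<kappa> x \<rightarrow>\<^sub>M ?N" by measurable
      have Zx: "Pair x -` Z \<in> sets ?N" using sets_Pair1[OF Z] .
      have "(\<integral>\<^sup>+ y. indicator Z (x, y) \<partial>K x) = (\<integral>\<^sup>+ y. indicator (Pair x -` Z) y \<partial>K x)"
        by (intro nn_integral_cong) (auto simp: indicator_def)
      also have "\<dots> = emeasure (K x) (Pair x -` Z)" using Zx by (simp add: K_def)
      also have "\<dots> = emeasure (\<kappa> x) (h -` (Pair x -` Z) \<inter> space (\<kappa> x))"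
        unfolding K_def by (rule emeasure_distr[OF m Zx])
      also have "h -` (Pair x -` Z) \<inter> space (\<kappa> x) = Pair x -` Z'"
        using x sets_eq_imp_space_eq[OF \<kappa>x] by (auto simp: Z'_def H_def space_pair_measure)
      finally show "emeasure (\<kappa> x) (Pair x -` Z') = (\<integral>\<^sup>+ y. indicator Z (x, y) \<partial>K x)" by simp
    qed
    finally show ?thesis .
  qed
  with K have "is_disintegration \<Omega> \<gamma> K" by (simp add: is_disintegration_def)
  then show ?thesis unfolding disintegration_def by (rule someI[of "is_disintegration \<Omega> \<gamma>"])
qed

section \<open>Barycenters as conditional means\<close>

abbreviation barycenter :: "'a::euclidean_space set \<Rightarrow> ('a \<times> 'a) measure \<Rightarrow> 'a \<Rightarrow> 'a" where
  "barycenter \<Omega> \<gamma> x \<equiv> \<integral>y. y \<partial>disintegration \<Omega> \<gamma> x"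

lemma kernel_borel_probs:
  assumes "compact \<Omega>" "\<gamma> \<in> borel_probs (\<Omega> \<times> \<Omega>)" "x \<in> \<Omega>"
  shows "disintegration \<Omega> \<gamma> x \<in> borel_probs \<Omega>"
proof -
  have "disintegration \<Omega> \<gamma> \<in> restrict_space borel \<Omega> \<rightarrow>\<^sub>M prob_algebra (restrict_space borel \<Omega>)"
    using is_disintegration_disintegration[OF assms(1,2)] unfolding is_disintegration_def by (rule conjunct1)
  from measurable_space[OF this, of x] assms(3) show ?thesis
    by (simp add: borel_probs_def space_restrict_space)
qed

lemma measurable_barycenter:
  assumes "compact \<Omega>" "\<gamma> \<in> borel_probs (\<Omega> \<times> \<Omega>)"
  shows "barycenter \<Omega> \<gamma> \<in> borel_measurable (restrict_space borel \<Omega>)"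
proof -
  have K: "disintegration \<Omega> \<gamma> \<in> restrict_space borel \<Omega> \<rightarrow>\<^sub>M subprob_algebra (restrict_space borel \<Omega>)"
    using is_disintegration_disintegration[OF assms] unfolding is_disintegration_def
    by (intro measurable_prob_algebraD) (rule conjunct1)
  have "(\<lambda>y. y) \<in> borel_measurable (restrict_space borel \<Omega>)"
    by (intro measurable_restrict_space1) auto
  from measurable_compose[OF K integral_measurable_subprob_algebra[OF this]] show ?thesis .
qed

lemma norm_barycenter_le:
  assumes "compact \<Omega>" "\<gamma> \<in> borel_probs (\<Omega> \<times> \<Omega>)" "x \<in> \<Omega>" "\<And>y. y \<in> \<Omega> \<Longrightarrow> norm y \<le> R"
  shows "norm (barycenter \<Omega> \<gamma> x) \<le> R"
proof -
  note K = kernel_borel_probs[OF assms(1-3)]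
  interpret prob_space "disintegration \<Omega> \<gamma> x" using K by (simp add: borel_probs_iff)
  have int: "integrable (disintegration \<Omega> \<gamma> x) (\<lambda>y. y)"
    by (rule integrable_borel_probs[OF K assms(1)]) (intro continuous_intros)
  have "norm (barycenter \<Omega> \<gamma> x) \<le> (\<integral>y. norm y \<partial>disintegration \<Omega> \<gamma> x)"
    by (rule integral_norm_bound)
  also have "\<dots> \<le> (\<integral>y. R \<partial>disintegration \<Omega> \<gamma> x)"
    using int assms(4) by (intro integral_mono) (auto simp: space_borel_probs[OF K])
  finally show ?thesis by (simp add: prob_space)
qed

text \<open>The disintegration identity is given for indicators only; it says that \<open>\<gamma>\<close> is the monadic bind of
  its first marginal with the kernel, from which it extends to bounded functions.\<close>

lemma integral_disintegration:
  fixes h :: "'a::euclidean_space \<times> 'a \<Rightarrow> real"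
  assumes \<Omega>: "compact \<Omega>" and \<gamma>: "\<gamma> \<in> borel_probs (\<Omega> \<times> \<Omega>)"
    and h: "h \<in> borel_measurable (restrict_space borel (\<Omega> \<times> \<Omega>))" "\<And>z. z \<in> \<Omega> \<times> \<Omega> \<Longrightarrow> \<bar>h z\<bar> \<le> B"
  shows "(\<integral>z. h z \<partial>\<gamma>) = (\<integral>x. (\<integral>y. h (x, y) \<partial>disintegration \<Omega> \<gamma> x) \<partial>distr \<gamma> (restrict_space borel \<Omega>) fst)"
proof -
  let ?N = "restrict_space borel \<Omega>"
  let ?K = "disintegration \<Omega> \<gamma>"
  define \<mu> where "\<mu> = distr \<gamma> ?N fst"
  have K [measurable]: "?K \<in> ?N \<rightarrow>\<^sub>M prob_algebra ?N"
    and dis: "\<And>Z. Z \<in> sets (restrict_space borel (\<Omega> \<times> \<Omega>)) \<Longrightarrow>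
      emeasure \<gamma> Z = (\<integral>\<^sup>+ x. (\<integral>\<^sup>+ y. indicator Z (x, y) \<partial>?K x) \<partial>\<mu>)"
    using is_disintegration_disintegration[OF \<Omega> \<gamma>] unfolding is_disintegration_def \<mu>_def by blast+
  have \<gamma>_sets: "sets \<gamma> = sets (?N \<Otimes>\<^sub>M ?N)"
    using \<gamma> by (simp add: borel_probs_iff sets_restrict_borel_Times)
  have \<gamma>_space: "space \<gamma> = \<Omega> \<times> \<Omega>" using \<gamma> by (rule space_borel_probs)
  have N: "space ?N = \<Omega>" by (simp add: space_restrict_space)
  have fst_\<gamma>: "fst \<in> \<gamma> \<rightarrow>\<^sub>M ?N" by (simp add: measurable_cong_sets[OF \<gamma>_sets refl])
  have \<mu>: "\<mu> \<in> space (prob_algebra ?N)"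
    using \<gamma> prob_space.prob_space_distr[OF _ fst_\<gamma>] by (simp add: \<mu>_def space_prob_algebra borel_probs_iff)
  have \<mu>_space: "space \<mu> = \<Omega>" by (simp add: \<mu>_def N)
  define Q where "Q x = distr (?K x) (?N \<Otimes>\<^sub>M ?N) (Pair x)" for x
  have Q [measurable]: "Q \<in> ?N \<rightarrow>\<^sub>M prob_algebra (?N \<Otimes>\<^sub>M ?N)" unfolding Q_def by measurable
  have Q': "Q \<in> \<mu> \<rightarrow>\<^sub>M prob_algebra (?N \<Otimes>\<^sub>M ?N)"
    by (simp add: \<mu>_def Q)
  have K_sets: "sets (?K x) = sets ?N" if "x \<in> \<Omega>" for x
    using kernel_borel_probs[OF \<Omega> \<gamma> that] by (simp add: borel_probs_iff)
  have Pair_K: "Pair x \<in> ?K x \<rightarrow>\<^sub>M ?N \<Otimes>\<^sub>M ?N" if "x \<in> \<Omega>" for x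
    using that by (simp add: measurable_cong_sets[OF K_sets[OF that] refl] N)
  have "\<gamma> = \<mu> \<bind> Q"
  proof (rule measure_eqI)
    show "sets \<gamma> = sets (\<mu> \<bind> Q)" using sets_bind'[OF \<mu> Q] \<gamma>_sets by simp
    fix Z assume "Z \<in> sets \<gamma>"
    then have Z: "Z \<in> sets (?N \<Otimes>\<^sub>M ?N)" by (simp add: \<gamma>_sets)
    have "emeasure (\<mu> \<bind> Q) Z = (\<integral>\<^sup>+x. emeasure (Q x) Z \<partial>\<mu>)"
      by (rule emeasure_bind_prob_algebra[OF \<mu> Q Z])
    also have "\<dots> = (\<integral>\<^sup>+ x. (\<integral>\<^sup>+ y. indicator Z (x, y) \<partial>?K x) \<partial>\<mu>)"
    proof (rule nn_integral_cong)
      fix x assume "x \<in> space \<mu>"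
      then have x: "x \<in> \<Omega>" by (simp add: \<mu>_space)
      have "(\<integral>\<^sup>+ z. indicator Z z \<partial>Q x) = (\<integral>\<^sup>+ y. indicator Z (x, y) \<partial>?K x)"
        unfolding Q_def by (rule nn_integral_distr[OF Pair_K[OF x]]) (use Z in simp)
      moreover have "Z \<in> sets (Q x)" using Z by (simp add: Q_def)
      ultimately show "emeasure (Q x) Z = (\<integral>\<^sup>+ y. indicator Z (x, y) \<partial>?K x)" by simp
    qed
    also have "\<dots> = emeasure \<gamma> Z"
      using Z by (intro dis[symmetric]) (simp add: sets_restrict_borel_Times)
    finally show "emeasure \<gamma> Z = emeasure (\<mu> \<bind> Q) Z" by simp
  qed
  moreover have "(\<integral>z. h z \<partial>(\<mu> \<bind> Q)) = (\<integral>x. (\<integral>z. h z \<partial>Q x) \<partial>\<mu>)"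
  proof (rule integral_bind[where K = "?N \<Otimes>\<^sub>M ?N" and B = B and B' = 1])
    show "h \<in> borel_measurable (?N \<Otimes>\<^sub>M ?N)"
      using h(1) by (simp add: measurable_cong_sets[OF sets_restrict_borel_Times refl])
    show "\<bar>h z\<bar> \<le> B" if "z \<in> space (?N \<Otimes>\<^sub>M ?N)" for z
      using that h(2) by (simp add: space_pair_measure N)
    show "Q \<in> \<mu> \<rightarrow>\<^sub>M subprob_algebra (?N \<Otimes>\<^sub>M ?N)" using Q' by (rule measurable_prob_algebraD)
    show "finite_measure \<mu>" using \<mu> by (simp add: space_prob_algebra prob_space_def)
    show "AE x in \<mu>. emeasure (Q x) (space (Q x)) \<le> ennreal 1"
      using measurable_space[OF Q'] by (intro AE_I2) (auto simp: space_prob_algebra prob_space.emeasure_space_1)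
  qed
  moreover have "(\<integral>x. (\<integral>z. h z \<partial>Q x) \<partial>\<mu>) = (\<integral>x. (\<integral>y. h (x, y) \<partial>?K x) \<partial>\<mu>)"
  proof (rule Bochner_Integration.integral_cong[OF refl])
    fix x assume "x \<in> space \<mu>"
    then have x: "x \<in> \<Omega>" by (simp add: \<mu>_space)
    show "(\<integral>z. h z \<partial>Q x) = (\<integral>y. h (x, y) \<partial>?K x)"
      unfolding Q_def
      by (rule integral_distr[OF Pair_K[OF x]])
         (use h(1) in \<open>simp add: measurable_cong_sets[OF sets_restrict_borel_Times refl]\<close>)
  qed
  ultimately show ?thesis unfolding \<mu>_def by metis
qed

text \<open>The barycenter is the conditional mean of the second coordinate given the first.\<close>

lemma integral_barycenter:
  fixes \<phi> :: "'a::euclidean_space \<Rightarrow> real"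
  assumes \<Omega>: "compact \<Omega>" and \<gamma>: "\<gamma> \<in> borel_probs (\<Omega> \<times> \<Omega>)"
    and \<phi>: "\<phi> \<in> borel_measurable (restrict_space borel \<Omega>)" "\<And>x. x \<in> \<Omega> \<Longrightarrow> \<bar>\<phi> x\<bar> \<le> B"
  shows "(\<integral>z. \<phi> (fst z) * (snd z \<bullet> e) \<partial>\<gamma>) = (\<integral>z. \<phi> (fst z) * (barycenter \<Omega> \<gamma> (fst z) \<bullet> e) \<partial>\<gamma>)"
proof -
  let ?N = "restrict_space borel \<Omega>"
  obtain R where R: "\<forall>x\<in>\<Omega>. norm x \<le> R" using compact_imp_bounded[OF \<Omega>] unfolding bounded_iff by blast
  have N: "space ?N = \<Omega>" by (simp add: space_restrict_space)
  have fst_r [measurable]: "fst \<in> restrict_space borel (\<Omega> \<times> \<Omega>) \<rightarrow>\<^sub>M ?N"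
    and snd_r [measurable]: "snd \<in> restrict_space borel (\<Omega> \<times> \<Omega>) \<rightarrow>\<^sub>M ?N"
    by (simp_all add: measurable_cong_sets[OF sets_restrict_borel_Times refl])
  have fst_\<gamma>: "fst \<in> \<gamma> \<rightarrow>\<^sub>M ?N" using fst_r \<gamma> by (simp add: borel_probs_iff cong: measurable_cong_sets)
  have id_N: "(\<lambda>y. y) \<in> borel_measurable ?N" by (intro measurable_restrict_space1) auto
  note [measurable] = \<phi>(1) measurable_compose[OF snd_r id_N] measurable_barycenter[OF \<Omega> \<gamma>]
  have bound: "\<bar>\<phi> x * (y \<bullet> e)\<bar> \<le> B * (R * norm e)" if "x \<in> \<Omega>" "norm y \<le> R" for x y
  proof -
    have "\<bar>y \<bullet> e\<bar> \<le> R * norm e"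
      using Cauchy_Schwarz_ineq2[of y e] mult_right_mono[OF that(2), of "norm e"] by auto
    then show ?thesis unfolding abs_mult
      using \<phi>(2)[OF that(1)] by (intro mult_mono) auto
  qed
  have "(\<integral>z. \<phi> (fst z) * (snd z \<bullet> e) \<partial>\<gamma>)
      = (\<integral>x. (\<integral>y. \<phi> x * (y \<bullet> e) \<partial>disintegration \<Omega> \<gamma> x) \<partial>distr \<gamma> ?N fst)"
    by (subst integral_disintegration[OF \<Omega> \<gamma>, where B = "B * (R * norm e)"]) (use R bound in auto)
  also have "\<dots> = (\<integral>x. \<phi> x * (barycenter \<Omega> \<gamma> x \<bullet> e) \<partial>distr \<gamma> ?N fst)"
  proof (rule Bochner_Integration.integral_cong[OF refl])
    fix x assume "x \<in> space (distr \<gamma> ?N fst)"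
    then have K: "disintegration \<Omega> \<gamma> x \<in> borel_probs \<Omega>"
      using kernel_borel_probs[OF \<Omega> \<gamma>] by (simp add: N)
    have "integrable (disintegration \<Omega> \<gamma> x) (\<lambda>y. y)"
      by (rule integrable_borel_probs[OF K \<Omega>]) (intro continuous_intros)
    then show "(\<integral>y. \<phi> x * (y \<bullet> e) \<partial>disintegration \<Omega> \<gamma> x) = \<phi> x * (barycenter \<Omega> \<gamma> x \<bullet> e)" by simp
  qed
  also have "\<dots> = (\<integral>z. \<phi> (fst z) * (barycenter \<Omega> \<gamma> (fst z) \<bullet> e) \<partial>\<gamma>)"
    by (rule integral_distr[OF fst_\<gamma>]) measurable
  finally show ?thesis .
qed

text \<open>For a bound \<open>c\<close> of \<open>\<bar>h\<bar>\<close>, the densities \<open>h + c\<close> and \<open>c\<close> are nonnegative. The hypothesis says that the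
  images under \<open>f\<close> of the two measures they define have the same integrals of continuous functions,
  so these images coincide.\<close>

lemma integral_zero_continuous_imp_measurable:
  fixes f :: "'b::euclidean_space \<Rightarrow> 'c::euclidean_space" and h :: "'b \<Rightarrow> real" and \<phi> :: "'c \<Rightarrow> real"
  assumes T: "compact T" and \<theta>: "\<theta> \<in> borel_probs T"
    and f: "continuous_on UNIV f" "f ` T \<subseteq> A" and h: "continuous_on UNIV h"
    and zero: "\<And>\<psi>. continuous_on UNIV \<psi> \<Longrightarrow> (\<integral>z. \<psi> (f z) * h z \<partial>\<theta>) = 0"
    and \<phi>: "\<phi> \<in> borel_measurable (restrict_space borel A)" "\<And>x. x \<in> A \<Longrightarrow> \<bar>\<phi> x\<bar> \<le> B"
  shows "(\<integral>z. \<phi> (f z) * h z \<partial>\<theta>) = 0"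
proof -
  let ?N = "restrict_space borel A"
  interpret prob_space \<theta> using \<theta> by (simp add: borel_probs_iff)
  have "bounded (h ` T)"
    by (intro compact_imp_bounded compact_continuous_image T continuous_on_subset[OF h]) auto
  then obtain c where c: "0 < c" "\<And>z. z \<in> T \<Longrightarrow> \<bar>h z\<bar> \<le> c" unfolding bounded_pos by auto
  have sp: "space \<theta> = T" using \<theta> by (rule space_borel_probs)
  have f_m [measurable]: "f \<in> \<theta> \<rightarrow>\<^sub>M ?N"
    using f by (intro distr_borel_probs(2)[OF \<theta>] measurable_borel_probs[OF \<theta>] borel_measurable_continuous_onI) auto
  have h_m [measurable]: "h \<in> borel_measurable \<theta>"
    by (intro measurable_borel_probs[OF \<theta>] borel_measurable_continuous_onI h)
  define W where "W k = distr (density \<theta> (\<lambda>z. ennreal (k z))) ?N f" for k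
  have W_int: "(\<integral>x. \<psi> x \<partial>W k) = (\<integral>z. k z * \<psi> (f z) \<partial>\<theta>)"
    if \<psi>: "\<psi> \<in> borel_measurable ?N" and k: "k \<in> borel_measurable \<theta>" "\<And>z. z \<in> T \<Longrightarrow> 0 \<le> k z" for \<psi> k
  proof -
    have "(\<integral>x. \<psi> x \<partial>W k) = (\<integral>z. \<psi> (f z) \<partial>density \<theta> (\<lambda>z. ennreal (k z)))"
      unfolding W_def by (rule integral_distr) (use \<psi> in auto)
    also have "\<dots> = (\<integral>z. k z * \<psi> (f z) \<partial>\<theta>)"
      by (subst integral_density) (use k measurable_compose[OF f_m \<psi>] in \<open>auto simp: sp intro!: AE_I2\<close>)
    finally show ?thesis .
  qed
  have split: "(\<integral>z. (h z + c) * \<psi> (f z) \<partial>\<theta>) = (\<integral>z. \<psi> (f z) * h z \<partial>\<theta>) + (\<integral>z. c * \<psi> (f z) \<partial>\<theta>)"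
    if \<psi>: "\<psi> \<in> borel_measurable ?N" "\<And>x. x \<in> A \<Longrightarrow> \<bar>\<psi> x\<bar> \<le> b" for \<psi> :: "'c \<Rightarrow> real" and b
  proof -
    note [measurable] = measurable_compose[OF f_m \<psi>(1)]
    have fT: "f z \<in> A" if "z \<in> T" for z using that f(2) by auto
    have "integrable \<theta> (\<lambda>z. \<psi> (f z) * h z)"
    proof (rule integrable_const_bound[of _ "b * c"])
      show "AE z in \<theta>. norm (\<psi> (f z) * h z) \<le> b * c"
        using \<psi>(2)[OF fT] c by (intro AE_I2) (auto simp: sp abs_mult intro!: mult_mono intro: order_trans[OF abs_ge_zero])
    qed measurable
    moreover have "integrable \<theta> (\<lambda>z. \<psi> (f z))"
      using \<psi>(2)[OF fT] by (intro integrable_const_bound[of _ b] AE_I2) (auto simp: sp)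
    then have "integrable \<theta> (\<lambda>z. c * \<psi> (f z))" by simp
    ultimately have "(\<integral>z. \<psi> (f z) * h z + c * \<psi> (f z) \<partial>\<theta>) = (\<integral>z. \<psi> (f z) * h z \<partial>\<theta>) + (\<integral>z. c * \<psi> (f z) \<partial>\<theta>)"
      by (rule Bochner_Integration.integral_add)
    then show ?thesis by (simp add: algebra_simps)
  qed
  have pos: "0 \<le> h z + c" if "z \<in> T" for z using c(2)[OF that] by linarith
  have fin: "finite_measure (W k)" if k: "k \<in> borel_measurable \<theta>" "\<And>z. z \<in> T \<Longrightarrow> k z \<le> C" for k C
  proof
    have "emeasure (W k) (space (W k)) = (\<integral>\<^sup>+z. ennreal (k z) * indicator (f -` A \<inter> T) z \<partial>\<theta>)"
      using measurable_sets[OF f_m, of A] k f(2) sets.top[of ?N]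
      by (simp add: W_def emeasure_distr emeasure_density sp space_restrict_space)
    also have "\<dots> \<le> (\<integral>\<^sup>+z. ennreal C \<partial>\<theta>)"
      using k(2) by (intro nn_integral_mono) (auto simp: sp indicator_def intro!: ennreal_leI)
    also have "\<dots> < \<infinity>" by (simp add: emeasure_space_1)
    finally show "emeasure (W k) (space (W k)) \<noteq> \<infinity>" by simp
  qed
  have "W (\<lambda>z. h z + c) = W (\<lambda>_. c)"
  proof (rule finite_measure_eqI_continuous[of _ A])
    show "finite_measure (W (\<lambda>z. h z + c))"
      by (rule fin[of _ "2 * c"]) (use c(2) in \<open>auto simp: abs_le_iff\<close>)
    show "finite_measure (W (\<lambda>_. c))" by (rule fin[of _ c]) auto
    fix \<psi> :: "'c \<Rightarrow> real" assume \<psi>: "continuous_on UNIV \<psi>" "\<And>x. 0 \<le> \<psi> x \<and> \<psi> x \<le> 1"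
    then have m: "\<psi> \<in> borel_measurable ?N"
      by (intro measurable_restrict_space1 borel_measurable_continuous_onI)
    show "(\<integral>x. \<psi> x \<partial>W (\<lambda>z. h z + c)) = (\<integral>x. \<psi> x \<partial>W (\<lambda>_. c))"
      using W_int[OF m, of "\<lambda>z. h z + c"] W_int[OF m, of "\<lambda>_. c"] split[OF m, of 1] zero[OF \<psi>(1)] pos c(1) \<psi>(2)
      by simp
  qed (simp_all add: W_def)
  then have "(\<integral>x. \<phi> x \<partial>W (\<lambda>z. h z + c)) = (\<integral>x. \<phi> x \<partial>W (\<lambda>_. c))" by simp
  then show ?thesis
    using W_int[OF \<phi>(1), of "\<lambda>z. h z + c"] W_int[OF \<phi>(1), of "\<lambda>_. c"] split[OF \<phi>] pos c(1) by simp
qed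

text \<open>This is Young's inequality for \<open>t\<close> and \<open>s powr (p - 1)\<close>, with exponents \<open>p\<close> and \<open>p / (p - 1)\<close>.\<close>

lemma powr_above_tangent:
  fixes s t :: real
  assumes "1 < p" "0 \<le> s" "0 \<le> t"
  shows "s powr p + p * s powr (p - 1) * (t - s) \<le> t powr p"
proof -
  define q where "q = p / (p - 1)"
  have q: "q > 1" "1 / p + 1 / q = 1" using assms(1) by (auto simp: q_def field_simps)
  have "s powr (p - 1) * t \<le> t powr p / p + (s powr (p - 1)) powr q / q"
    using Youngs_inequality[of p q t "s powr (p - 1)"] assms q by (simp add: mult.commute)
  also have "(s powr (p - 1)) powr q / q = s powr p * (1 - 1 / p)"
  proof -
    have "(p - 1) * q = p" "1 / q = 1 - 1 / p" using assms(1) q by (auto simp: q_def)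
    then show ?thesis by (metis powr_powr times_divide_eq_right mult.right_neutral)
  qed
  finally have "p * (s powr (p - 1) * t) \<le> p * (t powr p / p + s powr p * (1 - 1 / p))"
    using assms(1) by (intro mult_left_mono) auto
  also have "\<dots> = t powr p + (p - 1) * s powr p"
    using assms(1) by (simp add: field_simps)
  finally have "p * (s powr (p - 1) * t) \<le> t powr p + (p - 1) * s powr p" .
  moreover have "s * s powr (p - 1) = s powr p"
    using assms powr_mult_base[of s "p - 1"] by simp
  ultimately show ?thesis by (simp add: algebra_simps)
qed

text \<open>The vector on the left is the gradient of \<open>|z|\<^sup>p\<close>. The convention \<open>0 powr (p - 2) = 0\<close> is
  harmless for \<open>p < 2\<close>, since the gradient at \<open>z = 0\<close> is zero.\<close>

lemma norm_powr_above_tangent: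
  fixes z w :: "'a::real_inner"
  assumes "1 < p"
  shows "norm z powr p + (p * norm z powr (p - 2)) *\<^sub>R z \<bullet> (w - z) \<le> norm w powr p"
proof -
  have *: "norm z powr (p - 2) * norm z = norm z powr (p - 1)"
    using powr_mult_base[of "norm z" "p - 2"] by (simp add: mult.commute)
  have "z \<bullet> (w - z) \<le> norm z * (norm w - norm z)"
    using norm_cauchy_schwarz[of z w] by (simp add: inner_diff_right algebra_simps power2_norm_eq_inner[symmetric] power2_eq_square)
  then have "(p * norm z powr (p - 2)) * (z \<bullet> (w - z)) \<le> (p * norm z powr (p - 2)) * (norm z * (norm w - norm z))"
    using assms by (intro mult_left_mono) auto
  also have "\<dots> = p * norm z powr (p - 1) * (norm w - norm z)"
    by (simp add: *[symmetric] mult.assoc)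
  finally show ?thesis
    using powr_above_tangent[OF assms, of "norm z" "norm w"] by simp
qed

section \<open>Barycentric plans\<close>

text \<open>Laws of triples \<open>(x, b, y)\<close> such that \<open>b\<close> and \<open>y\<close> have the same conditional mean given \<open>x\<close>. This
  last condition is tested on continuous functions of \<open>x\<close> only, so that it passes to weak limits,
  and \<open>b\<close> is confined to a ball, so that all plans are carried by one compact set.\<close>

definition barycentric_plans ::
    "'a::euclidean_space set \<Rightarrow> real \<Rightarrow> 'a measure \<Rightarrow> 'a measure \<Rightarrow> ('a \<times> 'a \<times> 'a) measure set" where
  "barycentric_plans \<Omega> R \<mu> \<nu> = {\<theta> \<in> borel_probs (\<Omega> \<times> cball 0 R \<times> \<Omega>).
     distr \<theta> (restrict_space borel \<Omega>) fst = \<mu> \<and>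
     distr \<theta> (restrict_space borel \<Omega>) (\<lambda>z. snd (snd z)) = \<nu> \<and>
     (\<forall>\<phi> e. continuous_on UNIV \<phi> \<longrightarrow>
        (\<integral>z. \<phi> (fst z) * ((snd (snd z) - fst (snd z)) \<bullet> e) \<partial>\<theta>) = 0)}"

lemma barycentric_plansD:
  assumes "\<theta> \<in> barycentric_plans \<Omega> R \<mu> \<nu>"
  shows "\<theta> \<in> borel_probs (\<Omega> \<times> cball 0 R \<times> \<Omega>)"
    and "distr \<theta> (restrict_space borel \<Omega>) fst = \<mu>"
    and "distr \<theta> (restrict_space borel \<Omega>) (\<lambda>z. snd (snd z)) = \<nu>"
    and "continuous_on UNIV \<phi> \<Longrightarrow> (\<integral>z. \<phi> (fst z) * ((snd (snd z) - fst (snd z)) \<bullet> e) \<partial>\<theta>) = 0"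
  using assms unfolding barycentric_plans_def by blast+

definition plan_cost :: "real \<Rightarrow> ('a::euclidean_space \<times> 'a \<times> 'a) measure \<Rightarrow> real" where
  "plan_cost p \<theta> = (\<integral>z. norm (fst z - fst (snd z)) powr p \<partial>\<theta>)"

lemma continuous_on_plan_cost_integrand:
  assumes "0 < p"
  shows "continuous_on UNIV (\<lambda>z :: 'a::euclidean_space \<times> 'a \<times> 'a. norm (fst z - fst (snd z)) powr p)"
  using assms by (intro continuous_intros continuous_on_powr') auto

text \<open>The plan is the law of \<open>(x, b(x), y)\<close> under the coupling, with \<open>b(x)\<close> the barycenter of the kernel
  at \<open>x\<close>.\<close>

lemma plan_of_coupling:
  assumes \<Omega>: "compact \<Omega>" and R: "\<And>x. x \<in> \<Omega> \<Longrightarrow> norm x \<le> R" and p: "0 < p"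
    and \<gamma>: "\<gamma> \<in> couplings \<Omega> \<mu> \<nu>"
  obtains \<theta> where "\<theta> \<in> barycentric_plans \<Omega> R \<mu> \<nu>"
    "ennreal (plan_cost p \<theta>) = (\<integral>\<^sup>+x. ennreal (norm (x - barycenter \<Omega> \<gamma> x) powr p) \<partial>\<mu>)"
proof -
  let ?N = "restrict_space borel \<Omega>" and ?N3 = "restrict_space borel (\<Omega> \<times> cball (0::'a) R \<times> \<Omega>)"
  have \<gamma>_prob: "\<gamma> \<in> borel_probs (\<Omega> \<times> \<Omega>)" and marg: "distr \<gamma> ?N fst = \<mu>" "distr \<gamma> ?N snd = \<nu>"
    using \<gamma> by (auto simp: couplings_def)
  interpret prob_space \<gamma> using \<gamma>_prob by (simp add: borel_probs_iff)
  have sp: "space \<gamma> = \<Omega> \<times> \<Omega>" by (rule space_borel_probs[OF \<gamma>_prob])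
  let ?b = "barycenter \<Omega> \<gamma>"
  have b_N: "?b \<in> borel_measurable ?N" by (rule measurable_barycenter[OF \<Omega> \<gamma>_prob])
  have [measurable]: "fst \<in> borel_measurable \<gamma>" "snd \<in> borel_measurable \<gamma>"
    by (intro measurable_borel_probs[OF \<gamma>_prob] borel_measurable_continuous_onI continuous_intros)+
  have fst_N [measurable]: "fst \<in> \<gamma> \<rightarrow>\<^sub>M ?N" and snd_N: "snd \<in> \<gamma> \<rightarrow>\<^sub>M ?N"
    by (intro measurable_restrict_space2; force simp: sp)+
  note [measurable] = measurable_compose[OF fst_N b_N]
  define T where "T z = (fst z, ?b (fst z), snd z)" for z :: "'a \<times> 'a"
  have "(\<lambda>z. (fst z, ?b (fst z), snd z)) \<in> \<gamma> \<rightarrow>\<^sub>M borel \<Otimes>\<^sub>M borel \<Otimes>\<^sub>M borel" by measurable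
  then have T_borel: "T \<in> borel_measurable \<gamma>" by (simp add: borel_prod T_def[abs_def])
  have T_range: "T \<in> \<Omega> \<times> \<Omega> \<rightarrow> \<Omega> \<times> cball 0 R \<times> \<Omega>"
    using norm_barycenter_le[OF \<Omega> \<gamma>_prob _ R] by (auto simp: T_def)
  define \<theta> where "\<theta> = distr \<gamma> ?N3 T"
  have \<theta>: "\<theta> \<in> borel_probs (\<Omega> \<times> cball 0 R \<times> \<Omega>)" and T: "T \<in> \<gamma> \<rightarrow>\<^sub>M ?N3"
    unfolding \<theta>_def using distr_borel_probs[OF \<gamma>_prob T_range T_borel] by auto
  have \<theta>_int: "(\<integral>z. h z \<partial>\<theta>) = (\<integral>z. h (T z) \<partial>\<gamma>)" if "continuous_on UNIV h" for h :: "'a \<times> 'a \<times> 'a \<Rightarrow> real"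
    unfolding \<theta>_def
    by (rule integral_distr[OF T]) (intro measurable_restrict_space1 borel_measurable_continuous_onI that)
  have "distr \<theta> ?N fst = \<mu>" "distr \<theta> ?N (\<lambda>z. snd (snd z)) = \<nu>"
  proof -
    have m: "f \<in> ?N3 \<rightarrow>\<^sub>M ?N" if "continuous_on UNIV f" "f ` (\<Omega> \<times> cball 0 R \<times> \<Omega>) \<subseteq> \<Omega>" for f :: "'a \<times> 'a \<times> 'a \<Rightarrow> 'a"
      using that by (intro measurable_restrict_space2 measurable_restrict_space1 borel_measurable_continuous_onI)
        (auto simp: space_restrict_space)
    have f: "fst \<in> ?N3 \<rightarrow>\<^sub>M ?N" "(\<lambda>z. snd (snd z)) \<in> ?N3 \<rightarrow>\<^sub>M ?N"
      by (rule m; force intro: continuous_intros)+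
    show "distr \<theta> ?N fst = \<mu>" "distr \<theta> ?N (\<lambda>z. snd (snd z)) = \<nu>"
      unfolding \<theta>_def by (simp_all add: distr_distr[OF f(1) T] distr_distr[OF f(2) T] T_def comp_def marg)
  qed
  moreover have "(\<integral>z. \<phi> (fst z) * ((snd (snd z) - fst (snd z)) \<bullet> e) \<partial>\<theta>) = 0"
    if \<phi>: "continuous_on UNIV \<phi>" for \<phi> :: "'a \<Rightarrow> real" and e
  proof -
    have "bounded (\<phi> ` \<Omega>)"
      by (intro compact_imp_bounded compact_continuous_image \<Omega> continuous_on_subset[OF \<phi>]) auto
    then obtain B where B: "\<forall>x\<in>\<Omega>. \<bar>\<phi> x\<bar> \<le> B" unfolding bounded_iff by auto
    have \<phi>_m [measurable]: "\<phi> \<in> borel_measurable ?N" "\<phi> \<in> borel_measurable borel"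
      by (intro measurable_restrict_space1 borel_measurable_continuous_onI \<phi>)+
    have int: "integrable \<gamma> (\<lambda>z. \<phi> (fst z) * (k z \<bullet> e))"
      if [measurable]: "k \<in> borel_measurable \<gamma>" and k: "\<And>z. z \<in> \<Omega> \<times> \<Omega> \<Longrightarrow> norm (k z) \<le> R" for k
    proof (rule integrable_const_bound[of _ "B * (R * norm e)"])
      show "AE z in \<gamma>. norm (\<phi> (fst z) * (k z \<bullet> e)) \<le> B * (R * norm e)"
      proof (rule AE_I2)
        fix z assume "z \<in> space \<gamma>"
        then have z: "z \<in> \<Omega> \<times> \<Omega>" by (simp add: sp)
        have "\<bar>k z \<bullet> e\<bar> \<le> R * norm e"
          using Cauchy_Schwarz_ineq2[of "k z" e] mult_right_mono[OF k[OF z], of "norm e"] by auto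
        moreover have "\<bar>\<phi> (fst z)\<bar> \<le> B" using B z by auto
        ultimately show "norm (\<phi> (fst z) * (k z \<bullet> e)) \<le> B * (R * norm e)"
          unfolding real_norm_def abs_mult by (intro mult_mono) auto
      qed
    qed measurable
    have "(\<integral>z. \<phi> (fst z) * ((snd (snd z) - fst (snd z)) \<bullet> e) \<partial>\<theta>)
        = (\<integral>z. \<phi> (fst z) * ((snd z - ?b (fst z)) \<bullet> e) \<partial>\<gamma>)"
    proof (subst \<theta>_int)
      show "continuous_on UNIV (\<lambda>z. \<phi> (fst z) * ((snd (snd z) - fst (snd z)) \<bullet> e))"
        by (intro continuous_intros continuous_on_compose2[OF \<phi>]) auto
    qed (simp add: T_def)
    also have "\<dots> = (\<integral>z. \<phi> (fst z) * (snd z \<bullet> e) \<partial>\<gamma>) - (\<integral>z. \<phi> (fst z) * (?b (fst z) \<bullet> e) \<partial>\<gamma>)"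
      unfolding inner_diff_left right_diff_distrib
      by (intro Bochner_Integration.integral_diff int) (use R norm_barycenter_le[OF \<Omega> \<gamma>_prob _ R] in auto)
    also have "\<dots> = 0"
      using integral_barycenter[OF \<Omega> \<gamma>_prob \<phi>_m(1), of B e] B by simp
    finally show ?thesis .
  qed
  ultimately have "\<theta> \<in> barycentric_plans \<Omega> R \<mu> \<nu>"
    using \<theta> by (simp add: barycentric_plans_def)
  moreover have "ennreal (plan_cost p \<theta>) = (\<integral>\<^sup>+x. ennreal (norm (x - ?b x) powr p) \<partial>\<mu>)"
  proof -
    have "compact (\<Omega> \<times> cball (0::'a) R \<times> \<Omega>)" by (intro compact_Times \<Omega> compact_cball)
    then have "integrable \<theta> (\<lambda>z. norm (fst z - fst (snd z)) powr p)"
      by (rule integrable_borel_probs[OF \<theta> _ continuous_on_plan_cost_integrand[OF p]])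
    then have "ennreal (plan_cost p \<theta>) = (\<integral>\<^sup>+z. ennreal (norm (fst z - fst (snd z)) powr p) \<partial>\<theta>)"
      unfolding plan_cost_def by (intro nn_integral_eq_integral[symmetric]) auto
    also have "\<dots> = (\<integral>\<^sup>+z. ennreal (norm (fst z - ?b (fst z)) powr p) \<partial>\<gamma>)"
      unfolding \<theta>_def
      by (subst nn_integral_distr[OF T])
         (auto intro!: measurable_restrict_space1 borel_measurable_continuous_onI continuous_on_plan_cost_integrand p simp: T_def)
    also have "\<dots> = (\<integral>\<^sup>+x. ennreal (norm (x - ?b x) powr p) \<partial>distr \<gamma> ?N fst)"
    proof (rule nn_integral_distr[symmetric, OF fst_N, where f = "\<lambda>x. ennreal (norm (x - ?b x) powr p)"])
      have "(\<lambda>x. x) \<in> borel_measurable ?N" by (intro measurable_restrict_space1) auto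
      then have "(\<lambda>x. ennreal (norm (x - ?b x) powr p)) \<in> borel_measurable ?N" using b_N by measurable
      then show "(\<lambda>x. ennreal (norm (x - ?b x) powr p)) \<in> borel_measurable (distr \<gamma> ?N fst)" by simp
    qed
    finally show ?thesis by (simp add: marg)
  qed
  ultimately show ?thesis by (rule that)
qed

text \<open>The plan restricts to a coupling \<open>\<gamma>\<close> of \<open>x\<close> and \<open>y\<close>, whose barycenter \<open>\<beta>(x)\<close> is the conditional
  mean of \<open>y\<close>, hence also of \<open>b\<close>. So \<open>|x - \<beta>(x)|\<^sup>p \<le> E[|x - b|\<^sup>p | x]\<close> is Jensen's inequality,
  obtained here from the supporting hyperplane of \<open>|z|\<^sup>p\<close> at \<open>z = x - \<beta>(x)\<close>: its linear term is a
  function \<open>v\<close> of \<open>x\<close> paired with \<open>\<beta>(x) - b\<close>, and integrates to zero. As \<open>v\<close> is merely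
  measurable, the moment condition is needed for measurable functions of \<open>x\<close>.\<close>

lemma weak_cost_le_plan_cost:
  assumes \<Omega>: "compact \<Omega>" and p: "1 < p" and \<theta>: "\<theta> \<in> barycentric_plans \<Omega> R \<mu> \<nu>"
  shows "weak_cost \<Omega> p \<nu> \<mu> \<le> ennreal (plan_cost p \<theta>)"
proof -
  let ?N = "restrict_space borel \<Omega>" and ?T = "\<Omega> \<times> cball (0::'a) R \<times> \<Omega>"
  have \<theta>_prob: "\<theta> \<in> borel_probs ?T"
    and marg: "distr \<theta> ?N fst = \<mu>" "distr \<theta> ?N (\<lambda>z. snd (snd z)) = \<nu>"
    and zero: "\<And>\<phi> e. continuous_on UNIV \<phi> \<Longrightarrow> (\<integral>z. \<phi> (fst z) * ((snd (snd z) - fst (snd z)) \<bullet> e) \<partial>\<theta>) = 0"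
    using \<theta> by (auto simp: barycentric_plans_def)
  interpret prob_space \<theta> using \<theta>_prob by (simp add: borel_probs_iff)
  have sp: "space \<theta> = ?T" by (rule space_borel_probs[OF \<theta>_prob])
  have T: "compact ?T" by (intro compact_Times \<Omega> compact_cball)
  have cont_m: "f \<in> borel_measurable \<theta>" if "continuous_on UNIV f" for f :: "'a \<times> 'a \<times> 'a \<Rightarrow> 'c::euclidean_space"
    by (intro measurable_borel_probs[OF \<theta>_prob] borel_measurable_continuous_onI that)
  define \<pi> :: "'a \<times> 'a \<times> 'a \<Rightarrow> 'a \<times> 'a" where "\<pi> z = (fst z, snd (snd z))" for z
  have "continuous_on UNIV \<pi>" unfolding \<pi>_def by (intro continuous_intros)
  note \<pi>_b = cont_m[OF this]
  define \<gamma> where "\<gamma> = distr \<theta> (restrict_space borel (\<Omega> \<times> \<Omega>)) \<pi>"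
  have \<gamma>_prob: "\<gamma> \<in> borel_probs (\<Omega> \<times> \<Omega>)" and \<pi>: "\<pi> \<in> \<theta> \<rightarrow>\<^sub>M restrict_space borel (\<Omega> \<times> \<Omega>)"
  proof -
    have "\<pi> \<in> ?T \<rightarrow> \<Omega> \<times> \<Omega>" by (auto simp: \<pi>_def)
    from distr_borel_probs[OF \<theta>_prob this \<pi>_b] show "\<gamma> \<in> borel_probs (\<Omega> \<times> \<Omega>)"
      "\<pi> \<in> \<theta> \<rightarrow>\<^sub>M restrict_space borel (\<Omega> \<times> \<Omega>)" by (simp_all add: \<gamma>_def)
  qed
  have fs: "fst \<in> restrict_space borel (\<Omega> \<times> \<Omega>) \<rightarrow>\<^sub>M ?N" "snd \<in> restrict_space borel (\<Omega> \<times> \<Omega>) \<rightarrow>\<^sub>M ?N"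
    by (simp_all add: measurable_cong_sets[OF sets_restrict_borel_Times refl])
  have \<gamma>: "\<gamma> \<in> couplings \<Omega> \<mu> \<nu>"
    using \<gamma>_prob marg unfolding couplings_def
    by (simp add: \<gamma>_def distr_distr[OF fs(1) \<pi>] distr_distr[OF fs(2) \<pi>] comp_def \<pi>_def)
  have \<gamma>_int: "(\<integral>z. k z \<partial>\<gamma>) = (\<integral>z. k (\<pi> z) \<partial>\<theta>)"
    if "k \<in> borel_measurable (restrict_space borel (\<Omega> \<times> \<Omega>))" for k :: "'a \<times> 'a \<Rightarrow> real"
    unfolding \<gamma>_def by (rule integral_distr[OF \<pi> that])
  let ?b = "barycenter \<Omega> \<gamma>"
  have b_N [measurable]: "?b \<in> borel_measurable ?N" by (rule measurable_barycenter[OF \<Omega> \<gamma>_prob])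
  have id_N [measurable]: "(\<lambda>x. x) \<in> borel_measurable ?N" by (intro measurable_restrict_space1) auto
  have fst_N: "fst \<in> \<theta> \<rightarrow>\<^sub>M ?N"
    using measurable_compose[OF \<pi> fs(1)] by (simp add: \<pi>_def)
  obtain S where S: "\<And>x. x \<in> \<Omega> \<Longrightarrow> norm x \<le> S" using compact_imp_bounded[OF \<Omega>] unfolding bounded_iff by blast
  have b_le: "norm (?b x) \<le> S" if "x \<in> \<Omega>" for x using norm_barycenter_le[OF \<Omega> \<gamma>_prob that S] .
  \<comment> \<open>The gradient of \<open>|z|\<^sup>p\<close> at \<open>z = x - \<beta>(x)\<close>.\<close>
  define v where "v x = (p * norm (x - ?b x) powr (p - 2)) *\<^sub>R (x - ?b x)" for x
  have v_N [measurable]: "v \<in> borel_measurable ?N" unfolding v_def by measurable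
  have v_le: "norm (v x) \<le> p * (2 * S) powr (p - 1)" if x: "x \<in> \<Omega>" for x
  proof -
    have "norm (v x) = p * norm (x - ?b x) powr (p - 1)"
      using powr_mult_base[of "norm (x - ?b x)" "p - 2"] p by (simp add: v_def mult.commute)
    also have "norm (x - ?b x) \<le> 2 * S" using norm_triangle_ineq4[of x "?b x"] S[OF x] b_le[OF x] by linarith
    then have "p * norm (x - ?b x) powr (p - 1) \<le> p * (2 * S) powr (p - 1)"
      using p by (intro mult_left_mono powr_mono2) auto
    finally show ?thesis .
  qed
  note [measurable] = measurable_compose[OF fst_N b_N] measurable_compose[OF fst_N v_N]
  have [measurable]: "(\<lambda>z. fst z) \<in> borel_measurable \<theta>" "(\<lambda>z. fst (snd z)) \<in> borel_measurable \<theta>"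
      "(\<lambda>z. snd (snd z)) \<in> borel_measurable \<theta>"
    by (intro cont_m continuous_intros)+

  \<comment> \<open>Coordinatewise, \<open>b\<close> is replaced by \<open>y\<close> through the moment condition and \<open>y\<close> by \<open>\<beta>(x)\<close> through the disintegration.\<close>
  have orth: "(\<integral>z. v (fst z) \<bullet> (?b (fst z) - fst (snd z)) \<partial>\<theta>) = 0"
  proof -
    have coord: "integrable \<theta> (\<lambda>z. (v (fst z) \<bullet> e) * ((?b (fst z) - fst (snd z)) \<bullet> e))
        \<and> (\<integral>z. (v (fst z) \<bullet> e) * ((?b (fst z) - fst (snd z)) \<bullet> e) \<partial>\<theta>) = 0" if e: "e \<in> Basis" for e
    proof -
      let ?\<phi> = "\<lambda>x. v x \<bullet> e" and ?B = "p * (2 * S) powr (p - 1)"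
      have \<phi>_N: "?\<phi> \<in> borel_measurable ?N" by measurable
      have \<phi>_le: "\<bar>?\<phi> x\<bar> \<le> ?B" if "x \<in> \<Omega>" for x
        using Basis_le_norm[OF e, of "v x"] v_le[OF that] by linarith
      have int: "integrable \<theta> (\<lambda>z. ?\<phi> (fst z) * (k z \<bullet> e))"
        if [measurable]: "k \<in> borel_measurable \<theta>" and k: "\<And>z. z \<in> ?T \<Longrightarrow> norm (k z) \<le> c" for k c
      proof (rule integrable_const_bound[of _ "?B * c"])
        show "AE z in \<theta>. norm (?\<phi> (fst z) * (k z \<bullet> e)) \<le> ?B * c"
        proof (rule AE_I2)
          fix z assume "z \<in> space \<theta>"
          then have z: "z \<in> ?T" by (simp add: sp)
          have "\<bar>k z \<bullet> e\<bar> \<le> c" using Basis_le_norm[OF e, of "k z"] k[OF z] by linarith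
          moreover have "\<bar>?\<phi> (fst z)\<bar> \<le> ?B" using \<phi>_le z by auto
          ultimately show "norm (?\<phi> (fst z) * (k z \<bullet> e)) \<le> ?B * c"
            unfolding real_norm_def abs_mult by (intro mult_mono) auto
        qed
      qed measurable
      have i: "integrable \<theta> (\<lambda>z. ?\<phi> (fst z) * (?b (fst z) \<bullet> e))"
        "integrable \<theta> (\<lambda>z. ?\<phi> (fst z) * (fst (snd z) \<bullet> e))"
        "integrable \<theta> (\<lambda>z. ?\<phi> (fst z) * (snd (snd z) \<bullet> e))"
        by (rule int[of _ S], measurable, use b_le in force)
           (rule int[of _ R], measurable, force, rule int[of _ S], measurable, use S in force)
      have "(\<integral>z. ?\<phi> (fst z) * ((snd (snd z) - fst (snd z)) \<bullet> e) \<partial>\<theta>) = 0"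
      proof (rule integral_zero_continuous_imp_measurable[OF T \<theta>_prob _ _ _ zero \<phi>_N \<phi>_le])
        show "continuous_on UNIV (\<lambda>z :: 'a \<times> 'a \<times> 'a. (snd (snd z) - fst (snd z)) \<bullet> e)" by (intro continuous_intros)
        show "continuous_on UNIV (fst :: 'a \<times> 'a \<times> 'a \<Rightarrow> 'a)" by (intro continuous_intros)
      qed auto
      then have "(\<integral>z. ?\<phi> (fst z) * (fst (snd z) \<bullet> e) \<partial>\<theta>) = (\<integral>z. ?\<phi> (fst z) * (snd (snd z) \<bullet> e) \<partial>\<theta>)"
        unfolding inner_diff_left right_diff_distrib using i by simp
      also have "\<dots> = (\<integral>z. ?\<phi> (fst z) * (snd z \<bullet> e) \<partial>\<gamma>)"
      proof (subst \<gamma>_int)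
        show "(\<lambda>z. ?\<phi> (fst z) * (snd z \<bullet> e)) \<in> borel_measurable (restrict_space borel (\<Omega> \<times> \<Omega>))"
          using measurable_compose[OF fs(1) \<phi>_N] measurable_compose[OF fs(2) id_N] by measurable
      qed (simp add: \<pi>_def)
      also have "\<dots> = (\<integral>z. ?\<phi> (fst z) * (?b (fst z) \<bullet> e) \<partial>\<gamma>)"
        by (rule integral_barycenter[OF \<Omega> \<gamma>_prob \<phi>_N \<phi>_le])
      also have "\<dots> = (\<integral>z. ?\<phi> (fst z) * (?b (fst z) \<bullet> e) \<partial>\<theta>)"
      proof (subst \<gamma>_int)
        show "(\<lambda>z. ?\<phi> (fst z) * (?b (fst z) \<bullet> e)) \<in> borel_measurable (restrict_space borel (\<Omega> \<times> \<Omega>))"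
          using measurable_compose[OF fs(1) \<phi>_N] measurable_compose[OF fs(1) b_N] by measurable
      qed (simp add: \<pi>_def)
      finally show ?thesis
        unfolding inner_diff_left right_diff_distrib using i by simp
    qed
    have "(\<integral>z. v (fst z) \<bullet> (?b (fst z) - fst (snd z)) \<partial>\<theta>)
        = (\<Sum>e\<in>Basis. \<integral>z. (v (fst z) \<bullet> e) * ((?b (fst z) - fst (snd z)) \<bullet> e) \<partial>\<theta>)"
      by (subst euclidean_inner) (use coord in \<open>auto intro: Bochner_Integration.integral_sum\<close>)
    then show ?thesis using coord by simp
  qed

  have bnd: "integrable \<theta> k" if [measurable]: "k \<in> borel_measurable \<theta>" and "\<And>z. z \<in> ?T \<Longrightarrow> \<bar>k z\<bar> \<le> c" for k :: "_ \<Rightarrow> real" and c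
    by (rule integrable_const_bound[of _ c]) (use that in \<open>auto simp: sp\<close>)
  have int1: "integrable \<theta> (\<lambda>z. norm (fst z - ?b (fst z)) powr p)"
  proof (rule bnd[of _ "(2 * S) powr p"])
    fix z assume "z \<in> ?T"
    then have x: "fst z \<in> \<Omega>" by auto
    have "norm (fst z - ?b (fst z)) \<le> 2 * S"
      using norm_triangle_ineq4[of "fst z" "?b (fst z)"] S[OF x] b_le[OF x] by linarith
    then show "\<bar>norm (fst z - ?b (fst z)) powr p\<bar> \<le> (2 * S) powr p"
      using p by (auto intro: powr_mono2)
  qed measurable
  have int2: "integrable \<theta> (\<lambda>z. v (fst z) \<bullet> (?b (fst z) - fst (snd z)))"
  proof (rule bnd[of _ "p * (2 * S) powr (p - 1) * (S + R)"])
    fix z assume "z \<in> ?T"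
    then have z: "fst z \<in> \<Omega>" "norm (fst (snd z)) \<le> R" by auto
    have "norm (?b (fst z) - fst (snd z)) \<le> S + R"
      using norm_triangle_ineq4[of "?b (fst z)" "fst (snd z)"] b_le[OF z(1)] z(2) by linarith
    then have "norm (v (fst z)) * norm (?b (fst z) - fst (snd z)) \<le> p * (2 * S) powr (p - 1) * (S + R)"
      using v_le[OF z(1)] p by (intro mult_mono) auto
    then show "\<bar>v (fst z) \<bullet> (?b (fst z) - fst (snd z))\<bar> \<le> p * (2 * S) powr (p - 1) * (S + R)"
      using Cauchy_Schwarz_ineq2[of "v (fst z)" "?b (fst z) - fst (snd z)"] by linarith
  qed measurable
  have int3: "integrable \<theta> (\<lambda>z. norm (fst z - fst (snd z)) powr p)"
    using p by (intro integrable_borel_probs[OF \<theta>_prob T continuous_on_plan_cost_integrand]) auto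
  have "(\<integral>z. norm (fst z - ?b (fst z)) powr p \<partial>\<theta>)
      = (\<integral>z. norm (fst z - ?b (fst z)) powr p + v (fst z) \<bullet> (?b (fst z) - fst (snd z)) \<partial>\<theta>)"
    using Bochner_Integration.integral_add[OF int1 int2] orth by simp
  also have "\<dots> \<le> plan_cost p \<theta>"
    unfolding plan_cost_def
  proof (rule integral_mono[OF Bochner_Integration.integrable_add[OF int1 int2] int3])
    fix z
    show "norm (fst z - ?b (fst z)) powr p + v (fst z) \<bullet> (?b (fst z) - fst (snd z)) \<le> norm (fst z - fst (snd z)) powr p"
      using norm_powr_above_tangent[OF p, of "fst z - ?b (fst z)" "fst z - fst (snd z)"] by (simp add: v_def)
  qed
  finally have le: "(\<integral>z. norm (fst z - ?b (fst z)) powr p \<partial>\<theta>) \<le> plan_cost p \<theta>" .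
  have "weak_cost \<Omega> p \<nu> \<mu> \<le> (\<integral>\<^sup>+x. ennreal (norm (x - ?b x) powr p) \<partial>\<mu>)"
    unfolding weak_cost_def by (rule INF_lower[OF \<gamma>])
  also have "\<dots> = (\<integral>\<^sup>+z. ennreal (norm (fst z - ?b (fst z)) powr p) \<partial>\<theta>)"
    unfolding marg(1)[symmetric] by (rule nn_integral_distr[OF fst_N]) measurable
  also have "\<dots> = ennreal (\<integral>z. norm (fst z - ?b (fst z)) powr p \<partial>\<theta>)"
    by (rule nn_integral_eq_integral[OF int1]) auto
  also have "\<dots> \<le> ennreal (plan_cost p \<theta>)" using le by (rule ennreal_leI)
  finally show ?thesis .
qed

section \<open>Lower semicontinuity and the minimizer\<close>

text \<open>Both the marginals and the moment condition are determined by integrals of continuous functions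
  of the triple.\<close>

lemma barycentric_plans_weakly_closed:
  fixes \<theta> :: "nat \<Rightarrow> ('a::euclidean_space \<times> 'a \<times> 'a) measure"
  assumes \<theta>: "\<And>n. \<theta> n \<in> barycentric_plans \<Omega> R (\<mu>' n) (\<nu>' n)" and L: "L \<in> borel_probs (\<Omega> \<times> cball 0 R \<times> \<Omega>)"
    and lim: "weakly_converges \<theta> L" "weakly_converges \<mu>' \<mu>" "weakly_converges \<nu>' \<nu>"
    and \<mu>: "\<mu> \<in> borel_probs \<Omega>" and \<nu>: "\<nu> \<in> borel_probs \<Omega>"
  shows "L \<in> barycentric_plans \<Omega> R \<mu> \<nu>"
proof -
  let ?N = "restrict_space borel \<Omega>"
  note \<theta>_prob = barycentric_plansD(1)[OF \<theta>] and marg = barycentric_plansD(2,3)[OF \<theta>]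
    and zero = barycentric_plansD(4)[OF \<theta>]
  have marginal: "distr L ?N f = \<rho>"
    if f: "continuous_on UNIV f" "f ` (\<Omega> \<times> cball 0 R \<times> \<Omega>) \<subseteq> \<Omega>"
      and \<rho>: "\<And>n. distr (\<theta> n) ?N f = \<rho>' n" "weakly_converges \<rho>' \<rho>" "\<rho> \<in> borel_probs \<Omega>" for f \<rho>' \<rho>
  proof (rule weakly_converges_unique)
    show "weakly_converges \<rho>' (distr L ?N f)"
      using weakly_converges_distr[OF lim(1) f(1) \<theta>_prob L f(2)] by (simp only: \<rho>(1))
    show "distr L ?N f \<in> borel_probs \<Omega>"
      using f(2) by (intro distr_borel_probs(1)[OF L _ measurable_borel_probs[OF L borel_measurable_continuous_onI[OF f(1)]]]) auto
  qed (rule \<rho>)+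
  have "distr L ?N fst = \<mu>"
    by (rule marginal[OF _ _ marg(1) lim(2) \<mu>]) (auto intro: continuous_intros)
  moreover have "distr L ?N (\<lambda>z. snd (snd z)) = \<nu>"
    by (rule marginal[OF _ _ marg(2) lim(3) \<nu>]) (auto intro!: continuous_intros)
  moreover have "(\<integral>z. \<phi> (fst z) * ((snd (snd z) - fst (snd z)) \<bullet> e) \<partial>L) = 0"
    if \<phi>: "continuous_on UNIV \<phi>" for \<phi> :: "'a \<Rightarrow> real" and e
  proof -
    have "continuous_on UNIV (\<lambda>z :: 'a \<times> 'a \<times> 'a. \<phi> (fst z) * ((snd (snd z) - fst (snd z)) \<bullet> e))"
      by (intro continuous_intros continuous_on_compose2[OF \<phi>]) auto
    from weakly_convergesD[OF lim(1) this] show ?thesis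
      by (simp add: zero[OF \<phi>] LIMSEQ_const_iff)
  qed
  ultimately show ?thesis using L by (simp add: barycentric_plans_def)
qed

text \<open>If the cost at the limit exceeded \<open>c\<close> while infinitely many of the costs were below \<open>c\<close>, plans
  of cost below \<open>c\<close> would have a weak limit that is a plan for \<open>\<mu>\<close> and \<open>\<nu>\<close> of cost at most
  \<open>c\<close>.\<close>

theorem weak_cost_lower_semicontinuous:
  fixes \<Omega> :: "'a::euclidean_space set"
  assumes \<Omega>: "compact \<Omega>" and p: "1 < p"
    and lim: "weakly_converges \<mu>' \<mu>" "weakly_converges \<nu>' \<nu>"
    and \<mu>: "\<mu> \<in> borel_probs \<Omega>" and \<nu>: "\<nu> \<in> borel_probs \<Omega>"
  shows "weak_cost \<Omega> p \<nu> \<mu> \<le> liminf (\<lambda>n. weak_cost \<Omega> p (\<nu>' n) (\<mu>' n))"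
proof (rule ccontr)
  assume "\<not> ?thesis"
  then have "liminf (\<lambda>n. weak_cost \<Omega> p (\<nu>' n) (\<mu>' n)) < weak_cost \<Omega> p \<nu> \<mu>" by (simp only: not_le)
  from dense[OF this] obtain c where c: "liminf (\<lambda>n. weak_cost \<Omega> p (\<nu>' n) (\<mu>' n)) < c" "c < weak_cost \<Omega> p \<nu> \<mu>"
    by blast
  obtain R where R: "\<And>x. x \<in> \<Omega> \<Longrightarrow> norm x \<le> R"
    using compact_imp_bounded[OF \<Omega>] unfolding bounded_iff by blast
  let ?T = "\<Omega> \<times> cball (0::'a) R \<times> \<Omega>"
  have T: "compact ?T" by (intro compact_Times \<Omega> compact_cball)
  have "\<not> (\<forall>\<^sub>F n in sequentially. c \<le> weak_cost \<Omega> p (\<nu>' n) (\<mu>' n))"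
  proof
    assume "\<forall>\<^sub>F n in sequentially. c \<le> weak_cost \<Omega> p (\<nu>' n) (\<mu>' n)"
    from Liminf_bounded[OF this] show False using c(1) by (simp only: leD)
  qed
  from not_eventually_sequentiallyD[OF this]
  obtain r :: "nat \<Rightarrow> nat" where r: "strict_mono r" "\<And>n. weak_cost \<Omega> p (\<nu>' (r n)) (\<mu>' (r n)) < c" by (auto simp: not_le)
  have "\<exists>\<theta> \<in> barycentric_plans \<Omega> R (\<mu>' (r n)) (\<nu>' (r n)). ennreal (plan_cost p \<theta>) < c" for n
  proof -
    from r(2)[of n] obtain \<gamma> where \<gamma>: "\<gamma> \<in> couplings \<Omega> (\<mu>' (r n)) (\<nu>' (r n))"
      "(\<integral>\<^sup>+x. ennreal (norm (x - barycenter \<Omega> \<gamma> x) powr p) \<partial>\<mu>' (r n)) < c"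
      unfolding weak_cost_def INF_less_iff by blast
    obtain \<theta> where "\<theta> \<in> barycentric_plans \<Omega> R (\<mu>' (r n)) (\<nu>' (r n))"
      "ennreal (plan_cost p \<theta>) = (\<integral>\<^sup>+x. ennreal (norm (x - barycenter \<Omega> \<gamma> x) powr p) \<partial>\<mu>' (r n))"
      by (rule plan_of_coupling[OF \<Omega> R _ \<gamma>(1), of p]) (use p in auto)
    then show ?thesis using \<gamma>(2) by (intro bexI[of _ \<theta>]) simp_all
  qed
  then obtain \<theta> where \<theta>: "\<And>n::nat. \<theta> n \<in> barycentric_plans \<Omega> R (\<mu>' (r n)) (\<nu>' (r n))" "\<And>n. ennreal (plan_cost p (\<theta> n)) < c"
    by metis
  have "\<theta> n \<in> borel_probs ?T" for n using \<theta>(1)[of n] by (simp add: barycentric_plans_def)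
  then obtain s :: "nat \<Rightarrow> nat" and L where s: "strict_mono s" and L: "L \<in> borel_probs ?T" and conv: "weakly_converges (\<theta> \<circ> s) L"
    by (rule weakly_compact_borel_probs[OF T])
  have sub: "weakly_converges (\<lambda>n. \<mu>' (r (s n))) \<mu>" "weakly_converges (\<lambda>n. \<nu>' (r (s n))) \<nu>"
    using weakly_converges_subseq[OF lim(1) strict_mono_o[OF r(1) s]]
      weakly_converges_subseq[OF lim(2) strict_mono_o[OF r(1) s]] by (simp_all add: o_def)
  have "L \<in> barycentric_plans \<Omega> R \<mu> \<nu>"
    by (rule barycentric_plans_weakly_closed[OF _ L conv sub \<mu> \<nu>]) (use \<theta>(1) in simp)
  then have "weak_cost \<Omega> p \<nu> \<mu> \<le> ennreal (plan_cost p L)" by (rule weak_cost_le_plan_cost[OF \<Omega> p])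
  moreover have "ennreal (plan_cost p L) \<le> c"
  proof (rule LIMSEQ_le_const2)
    have "(\<lambda>n. plan_cost p ((\<theta> \<circ> s) n)) \<longlonglongrightarrow> plan_cost p L"
      unfolding plan_cost_def using p by (intro weakly_convergesD[OF conv] continuous_on_plan_cost_integrand) auto
    then show "(\<lambda>n. ennreal (plan_cost p ((\<theta> \<circ> s) n))) \<longlonglongrightarrow> ennreal (plan_cost p L)" by (rule tendsto_ennrealI)
    show "\<exists>N. \<forall>n\<ge>N. ennreal (plan_cost p ((\<theta> \<circ> s) n)) \<le> c" using \<theta>(2) less_imp_le by auto
  qed
  ultimately show False using c(2) by simp
qed

definition centroid_term ::
    "'a::euclidean_space set \<Rightarrow> real \<Rightarrow> nat \<Rightarrow> (nat \<Rightarrow> 'a measure) \<Rightarrow> 'a measure \<Rightarrow> nat \<Rightarrow> ennreal" where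
  "centroid_term \<Omega> p M \<mu> \<nu> i = (if i \<le> M then weak_cost \<Omega> p \<nu> (\<mu> i) else weak_cost \<Omega> p (\<mu> i) \<nu>)"

text \<open>The weighted sum is written as an integral over a finite measure space so that Fatou's lemma
  applies to it.\<close>

lemma weak_centroid_objective_eq_nn_integral:
  assumes "M \<le> N"
  shows "weak_centroid_objective \<Omega> p M N w \<mu> \<nu>
    = (\<integral>\<^sup>+i. centroid_term \<Omega> p M \<mu> \<nu> i \<partial>point_measure {1..N} (\<lambda>i. ennreal (w i)))"
proof -
  have "(\<integral>\<^sup>+i. centroid_term \<Omega> p M \<mu> \<nu> i \<partial>point_measure {1..N} (\<lambda>i. ennreal (w i)))
      = (\<Sum>i\<in>{1..N}. ennreal (w i) * centroid_term \<Omega> p M \<mu> \<nu> i)"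
    by (subst nn_integral_point_measure_finite) auto
  also have "\<dots> = (\<Sum>i\<in>{M + 1..N}. ennreal (w i) * centroid_term \<Omega> p M \<mu> \<nu> i)
        + (\<Sum>i\<in>{1..M}. ennreal (w i) * centroid_term \<Omega> p M \<mu> \<nu> i)"
  proof -
    have "{1..N} = {M + 1..N} \<union> {1..M}" using assms by auto
    then show ?thesis by (simp only:) (rule sum.union_disjoint; auto)
  qed
  also have "\<dots> = weak_centroid_objective \<Omega> p M N w \<mu> \<nu>"
    unfolding weak_centroid_objective_def centroid_term_def by (intro arg_cong2[where f = "(+)"] sum.cong) auto
  finally show ?thesis by simp
qed

theorem lemma2p1:
  fixes \<Omega> :: "'a::euclidean_space set" and M N :: nat and p :: real
    and \<mu> :: "nat \<Rightarrow> 'a measure" and w :: "nat \<Rightarrow> real"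
  assumes "compact \<Omega>" and "convex \<Omega>"
    and "M \<le> N" and "N > 0"
    and "1 < p"
    and "\<And>i. i \<in> {1..N} \<Longrightarrow> \<mu> i \<in> borel_probs \<Omega>"
    and "w \<in> open_simplex N"
  shows "\<exists>\<nu> \<in> borel_probs \<Omega>.
    weak_centroid_objective \<Omega> p M N w \<mu> \<nu> = weak_centroid_value \<Omega> p M N w \<mu>"
proof -
  let ?F = "weak_centroid_objective \<Omega> p M N w \<mu>"
  have "\<mu> 1 \<in> borel_probs \<Omega>" using assms(4,6) by simp
  then have "?F ` borel_probs \<Omega> \<noteq> {}" by blast
  from Inf_as_limit[OF this] obtain u where u: "\<And>n. u n \<in> ?F ` borel_probs \<Omega>"
    and u_lim: "u \<longlonglongrightarrow> weak_centroid_value \<Omega> p M N w \<mu>"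
    unfolding weak_centroid_value_def by blast
  have "\<forall>n. \<exists>\<rho>. \<rho> \<in> borel_probs \<Omega> \<and> u n = ?F \<rho>" using u by (simp add: image_iff Bex_def)
  then obtain \<nu> where "\<forall>n. \<nu> n \<in> borel_probs \<Omega> \<and> u n = ?F (\<nu> n)"
    by (rule choice[THEN exE])
  then have \<nu>: "\<And>n. \<nu> n \<in> borel_probs \<Omega>" and u_eq: "\<And>n. u n = ?F (\<nu> n)" by simp_all
  obtain r :: "nat \<Rightarrow> nat" and L where r: "strict_mono r" and L: "L \<in> borel_probs \<Omega>" and conv: "weakly_converges (\<nu> \<circ> r) L"
    by (rule weakly_compact_borel_probs[where M = \<nu>, OF assms(1) \<nu>])
  let ?P = "point_measure {1..N} (\<lambda>i. ennreal (w i))"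
  have "?F L = (\<integral>\<^sup>+i. centroid_term \<Omega> p M \<mu> L i \<partial>?P)"
    by (rule weak_centroid_objective_eq_nn_integral[OF assms(3)])
  also have "\<dots> \<le> (\<integral>\<^sup>+i. liminf (\<lambda>n. centroid_term \<Omega> p M \<mu> ((\<nu> \<circ> r) n) i) \<partial>?P)"
  proof (rule nn_integral_mono)
    fix i assume "i \<in> space ?P"
    then have i: "\<mu> i \<in> borel_probs \<Omega>" using assms(6) by (simp add: space_point_measure)
    show "centroid_term \<Omega> p M \<mu> L i \<le> liminf (\<lambda>n. centroid_term \<Omega> p M \<mu> ((\<nu> \<circ> r) n) i)"
      unfolding centroid_term_def
      using weak_cost_lower_semicontinuous[OF assms(1,5) weakly_converges_const conv i L]
        weak_cost_lower_semicontinuous[OF assms(1,5) conv weakly_converges_const L i] by simp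
  qed
  also have "\<dots> \<le> liminf (\<lambda>n. \<integral>\<^sup>+i. centroid_term \<Omega> p M \<mu> ((\<nu> \<circ> r) n) i \<partial>?P)"
    by (rule nn_integral_liminf) (simp add: measurable_point_measure_eq1)
  also have "\<dots> = liminf (u \<circ> r)"
    by (simp add: o_def u_eq weak_centroid_objective_eq_nn_integral[OF assms(3)])
  also have "\<dots> = weak_centroid_value \<Omega> p M N w \<mu>"
    by (rule lim_imp_Liminf[OF sequentially_bot LIMSEQ_subseq_LIMSEQ[OF u_lim r]])
  finally have "?F L \<le> weak_centroid_value \<Omega> p M N w \<mu>" .
  moreover have "weak_centroid_value \<Omega> p M N w \<mu> \<le> ?F L"
    unfolding weak_centroid_value_def by (rule INF_lower[OF L])
  ultimately show ?thesis using L by (intro bexI[of _ L]) auto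
qed

end
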